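(* There are absolute constants $c_1,c_2>0$ such that for every integer $n'$ there exist an integer $n\ge n'$ and a set $X$ of $n$ points that is a permutation, such that $\mathrm{opt}(X)\ge c_1\, n\log\log n$ but $\mathrm{cGB}(X)\le c_2\, n\log\log\log n$.
   Context: Points have integer coordinates. Two points $p,q$ are collinear if $p.x=q.x$ or $p.y=q.y$; otherwise $\square_{p,q}$ is the smallest closed axis-parallel rectangle containing both. A non-collinear pair $(p,q)$ is satisfied in a set $S$ if some $r\in S\setminus\{p,q\}$ lies in $\square_{p,q}$; $S$ is satisfied if all its non-collinear pairs are satisfied in $S$. $X$ is a permutation if every horizontal line and every vertical line contains at most one point of $X$. $\mathrm{opt}(X)$ is the minimum $|Y|$ over point sets $Y$ with $X\cup Y$ satisfied. Consistent Guillotine bound: assume the $n$ points of $X$ have $x$-coordinates $\{1,\dots,n\}$ and $y$-coordinates $\{1,\dots,n\}$. Let $\mathcal L^V$ ($\mathcal L^H$) be the vertical (horizontal) lines with half-integral coordinate between $1/2$ and $n-1/2$, and $B$ a bounding box of $X$. For an ordering $\sigma$ of $\mathcal L^V\cup\mathcal L^H$, start with the partition $\mathcal P=\{B\}$ and process the lines in order; when line $L$ is processed, every rectangle $P\in\mathcal P$ intersecting $L$ is replaced by the two rectangles into which $L$ splits it, and the split of $P$ costs: if $L$ is vertical, the number of pairs of points of $X\cap P$ that are consecutive in increasing $y$-order and lie on opposite sides of $L$; if $L$ is horizontal, the number of pairs of points of $X\cap P$ consecutive in increasing $x$-order lying on opposite sides of $L$ (the cost is $0$ if $|X\cap P|\le1$).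 $\mathrm{cGB}_\sigma(X)$ is the total cost of all splits, and $\mathrm{cGB}(X)=\max_\sigma \mathrm{cGB}_\sigma(X)$. *)

theory Defs
  imports Complex_Main
begin

type_synonym point = "int \<times> int"

definition collinear :: "point \<Rightarrow> point \<Rightarrow> bool" where
  "collinear p q \<longleftrightarrow> fst p = fst q \<or> snd p = snd q"

definition box :: "point \<Rightarrow> point \<Rightarrow> point set" where
  "box p q = {r. min (fst p) (fst q) \<le> fst r \<and> fst r \<le> max (fst p) (fst q)
              \<and> min (snd p) (snd q) \<le> snd r \<and> snd r \<le> max (snd p) (snd q)}"

definition pair_satisfied :: "point set \<Rightarrow> point \<Rightarrow> point \<Rightarrow> bool" where
  "pair_satisfied S p q \<longleftrightarrow> (\<exists>r \<in> S - {p, q}. r \<in> box p q)"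

definition satisfied :: "point set \<Rightarrow> bool" where
  "satisfied S \<longleftrightarrow> (\<forall>p\<in>S. \<forall>q\<in>S. \<not> collinear p q \<longrightarrow> pair_satisfied S p q)"

definition is_permutation :: "point set \<Rightarrow> bool" where
  "is_permutation X \<longleftrightarrow> (\<forall>p\<in>X. \<forall>q\<in>X. (fst p = fst q \<or> snd p = snd q) \<longrightarrow> p = q)"

definition opt :: "point set \<Rightarrow> nat" where
  "opt X = (LEAST k. \<exists>Y. finite Y \<and> card Y = k \<and> satisfied (X \<union> Y))"

(* Lines of the guillotine bound: VL k is the vertical line x = k + 1/2,
   HL k is the horizontal line y = k + 1/2. *)
datatype gline = VL int | HL int

definition glines :: "nat \<Rightarrow> gline set" where
  "glines n = VL ` {1..int n - 1} \<union> HL ` {1..int n - 1}"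

(* A rectangle (a, b, c, d) of the partition contains exactly the lattice points
   [a..b] \<times> [c..d]; as a real rectangle it is [a-1/2, b+1/2] \<times> [c-1/2, d+1/2].
   Its boundary lines are the bounding box sides or already processed lines. *)
type_synonym rect = "int \<times> int \<times> int \<times> int"

definition in_rect :: "rect \<Rightarrow> point \<Rightarrow> bool" where
  "in_rect R p = (case R of (a, b, c, d) \<Rightarrow> a \<le> fst p \<and> fst p \<le> b \<and> c \<le> snd p \<and> snd p \<le> d)"

definition crosses :: "gline \<Rightarrow> rect \<Rightarrow> bool" where
  "crosses L R = (case R of (a, b, c, d) \<Rightarrow>
     (case L of VL k \<Rightarrow> a \<le> k \<and> k < b | HL k \<Rightarrow> c \<le> k \<and> k < d))"

fun split_rect :: "gline \<Rightarrow> rect \<Rightarrow> rect set" where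
  "split_rect (VL k) (a, b, c, d) = {(a, k, c, d), (k + 1, b, c, d)}"
| "split_rect (HL k) (a, b, c, d) = {(a, b, c, k), (a, b, k + 1, d)}"

definition split_all :: "gline \<Rightarrow> rect set \<Rightarrow> rect set" where
  "split_all L Ps = {R \<in> Ps. \<not> crosses L R} \<union> (\<Union>R \<in> {R \<in> Ps. crosses L R}. split_rect L R)"

definition split_cost :: "point set \<Rightarrow> gline \<Rightarrow> rect \<Rightarrow> nat" where
  "split_cost X L R = (let Q = {p \<in> X. in_rect R p} in
     case L of
       VL k \<Rightarrow> card {(p, q). p \<in> Q \<and> q \<in> Q \<and> snd p < snd q
                  \<and> \<not> (\<exists>r\<in>Q. snd p < snd r \<and> snd r < snd q)
                  \<and> ((fst p \<le> k) \<noteq> (fst q \<le> k))}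
     | HL k \<Rightarrow> card {(p, q). p \<in> Q \<and> q \<in> Q \<and> fst p < fst q
                  \<and> \<not> (\<exists>r\<in>Q. fst p < fst r \<and> fst r < fst q)
                  \<and> ((snd p \<le> k) \<noteq> (snd q \<le> k))})"

fun cGB_run :: "point set \<Rightarrow> rect set \<Rightarrow> gline list \<Rightarrow> nat" where
  "cGB_run X Ps [] = 0"
| "cGB_run X Ps (L # Ls) =
     (\<Sum>R \<in> {R \<in> Ps. crosses L R}. split_cost X L R) + cGB_run X (split_all L Ps) Ls"

(* cGB_sigma(X) for an ordering sigma, with X having coordinates in {1..n}, n = |X|,
   bounding box B = [1/2, n+1/2]^2 *)
definition cGB_sigma :: "point set \<Rightarrow> gline list \<Rightarrow> nat" where
  "cGB_sigma X \<sigma> = cGB_run X {(1, int (card X), 1, int (card X))} \<sigma>"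

definition cGB :: "point set \<Rightarrow> nat" where
  "cGB X = Max {cGB_sigma X \<sigma> | \<sigma>. distinct \<sigma> \<and> set \<sigma> = glines (card X)}"

end

theory Submission
  imports Defs
begin

text \<open>
  Let \<open>n = 2 ^ l\<close> and \<open>N = 2 ^ n\<close>. For all \<open>s, t < N\<close> take a bit reversal permutation on \<open>n\<close> points
  whose columns sit at the exponentially spaced positions \<open>s + 2 ^ i\<close> and whose rows sit at
  \<open>t + 2 ^ j\<close>, modulo \<open>N\<close>, and put it into cell \<open>(t, s)\<close> of an \<open>N \<times> N\<close> array. This gives
  \<open>N\<^sup>2 n\<close> points.

  A satisfied superset needs many points because each of the roughly \<open>n l / 2\<close> dyadic pairs in a
  block that does not wrap around forces a pair of horizontally adjacent points, and distinct pairs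
  force distinct ones.

  For the guillotine bound, the partition is at any time a product of two interval partitions, so
  vertical and horizontal lines can be treated separately and each cut is charged for a whole strip.
  Exponential spacing makes a cut of a strip of \<open>w\<close> blocks into parts with \<open>m \<le> w - m\<close> blocks cost
  about \<open>m log (w / m)\<close>: scales below \<open>m\<close> contribute a geometric series, scales above \<open>w\<close> meet the
  strip in isolated points that move across the cut monotonically, and only \<open>log (w / m)\<close> scales
  remain. These costs telescope against the potential \<open>w log w\<close>, so the bound is even \<open>O(|X|)\<close>.
\<close>

section \<open>Colour changes along a strip\<close>

definition strip :: "point set \<Rightarrow> int \<Rightarrow> int \<Rightarrow> point set" where
  "strip X a b = {p \<in> X. a \<le> fst p \<and> fst p \<le> b}"

definition alternations :: "point set \<Rightarrow> (point \<Rightarrow> bool) \<Rightarrow> (point \<times> point) set" where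
  "alternations S col = {(p, q). p \<in> S \<and> q \<in> S \<and> snd p < snd q
     \<and> \<not> (\<exists>r\<in>S. snd p < snd r \<and> snd r < snd q) \<and> col p \<noteq> col q}"

definition strip_cost :: "point set \<Rightarrow> int \<Rightarrow> int \<Rightarrow> int \<Rightarrow> nat" where
  "strip_cost X a b k = card (alternations (strip X a b) (\<lambda>p. fst p \<le> k))"

lemma finite_alternations: "finite S \<Longrightarrow> finite (alternations S col)"
  by (rule finite_subset[of _ "S \<times> S"]) (auto simp: alternations_def)

lemma switch_between:
  fixes b :: "int \<Rightarrow> bool"
  assumes "x < y" "b x \<noteq> b y"
  shows "\<exists>w. x \<le> w \<and> w < y \<and> b w \<noteq> b (w + 1)"
proof (rule ccontr)
  assume no: "\<not> ?thesis"
  have "b (x + int k) = b x" if "x + int k \<le> y" for k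
    using that
  proof (induction k)
    case (Suc k)
    moreover have "b (x + int k) = b (x + int k + 1)" using no Suc.prems by force
    ultimately show ?case by (simp add: algebra_simps)
  qed simp
  from this[of "nat (y - x)"] assms show False by simp
qed

text \<open>Each point of \<open>D\<close> is the lower end of at most one alternation and the upper
  end of at most one, which gives \<open>2 * card D\<close>. Any other alternation joins two heights
  at which \<open>b\<close> differs, so \<open>b\<close> switches somewhere between them;
  alternations span disjoint ranges of heights, so these switches are distinct elements of
  \<open>W\<close>.\<close>

lemma card_alternations_le:
  assumes fin: "finite S" and inj: "inj_on snd S" and D: "D \<subseteq> S" and W: "finite W"
    and col: "\<And>p. p \<in> S - D \<Longrightarrow> col p = b (snd p)"
    and sw: "\<And>p q w. p \<in> S \<Longrightarrow> q \<in> S \<Longrightarrow> snd p \<le> w \<Longrightarrow> w < snd q \<Longrightarrow> b w \<noteq> b (w + 1) \<Longrightarrow> w \<in> W"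
  shows "card (alternations S col) \<le> 2 * card D + card W"
proof -
  let ?A = "alternations S col"
  let ?A1 = "{(p, q) \<in> ?A. p \<in> D}" and ?A2 = "{(p, q) \<in> ?A. q \<in> D}"
    and ?A3 = "{(p, q) \<in> ?A. p \<notin> D \<and> q \<notin> D}"
  note defs = alternations_def
  have finA: "finite ?A" using fin by (rule finite_alternations)
  have finD: "finite D" using D fin by (rule finite_subset)
  have uniq: "q = q'" if "(p, q) \<in> ?A" "(p, q') \<in> ?A" for p q q'
  proof -
    have "snd q = snd q'" using that unfolding defs
      by (metis (mono_tags, lifting) case_prodD linorder_neqE mem_Collect_eq)
    with that inj show ?thesis unfolding defs inj_on_def by auto
  qed
  have uniq': "p = p'" if "(p, q) \<in> ?A" "(p', q) \<in> ?A" for p p' q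
  proof -
    have "snd p = snd p'" using that unfolding defs
      by (metis (mono_tags, lifting) case_prodD linorder_neqE mem_Collect_eq)
    with that inj show ?thesis unfolding defs inj_on_def by auto
  qed
  have 1: "card ?A1 \<le> card D"
    by (rule card_inj_on_le[where f = fst]) (auto simp: inj_on_def finD dest: uniq)
  have 2: "card ?A2 \<le> card D"
    by (rule card_inj_on_le[where f = snd]) (auto simp: inj_on_def finD dest: uniq')
  have ex: "\<exists>w. snd p \<le> w \<and> w < snd q \<and> b w \<noteq> b (w + 1)" if "(p, q) \<in> ?A3" for p q
    using that by (intro switch_between) (auto simp: defs col)
  define wit :: "point \<times> point \<Rightarrow> int"
    where "wit = (\<lambda>(p, q). SOME w. snd p \<le> w \<and> w < snd q \<and> b w \<noteq> b (w + 1))"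
  have wit: "snd p \<le> wit (p, q) \<and> wit (p, q) < snd q \<and> b (wit (p, q)) \<noteq> b (wit (p, q) + 1)"
    if "(p, q) \<in> ?A3" for p q
    unfolding wit_def prod.case using someI_ex[OF ex[OF that]] .
  have le: "snd p' \<le> snd p" if "(p, q) \<in> ?A3" "(p', q') \<in> ?A3" "wit (p, q) = wit (p', q')" for p q p' q'
  proof (rule ccontr)
    assume "\<not> snd p' \<le> snd p"
    then have "snd p < snd p'" by simp
    moreover have "p' \<in> S" "\<not> (\<exists>r\<in>S. snd p < snd r \<and> snd r < snd q)" using that by (simp_all add: defs)
    ultimately have "snd q \<le> snd p'" using not_less by blast
    with wit[OF that(1)] wit[OF that(2)] that(3) show False by linarith
  qed
  have inj3: "inj_on wit ?A3"
  proof (rule inj_onI)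
    fix e e' assume e: "e \<in> ?A3" "e' \<in> ?A3" "wit e = wit e'"
    obtain p q p' q' where pq: "e = (p, q)" "e' = (p', q')" by (cases e, cases e')
    have "snd p = snd p'" using le[of p q p' q'] le[of p' q' p q] e pq by auto
    moreover have "p \<in> S" "p' \<in> S" using e pq by (simp_all add: defs)
    ultimately have "p = p'" using inj by (simp add: inj_on_def)
    with uniq[of p q q'] e pq show "e = e'" by simp
  qed
  have "wit ` ?A3 \<subseteq> W"
  proof clarify
    fix p q assume pq: "(p, q) \<in> ?A" "p \<notin> D" "q \<notin> D"
    then have "p \<in> S" "q \<in> S" "(p, q) \<in> ?A3" by (simp_all add: defs)
    with wit[of p q] sw[of p q "wit (p, q)"] show "wit (p, q) \<in> W" by blast
  qed
  with inj3 W have 3: "card ?A3 \<le> card W" by (meson card_inj_on_le)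
  have "?A = ?A1 \<union> ?A2 \<union> ?A3" by auto
  then have "card ?A \<le> card ?A1 + card ?A2 + card ?A3"
    by (metis (no_types, lifting) card_Un_le add_le_mono1 le_trans)
  with 1 2 3 show ?thesis by linarith
qed

lemma card_alternations_le_twice:
  assumes fin: "finite S" and inj: "inj_on snd S" and D: "D \<subseteq> S"
    and col: "\<And>p. p \<in> S - D \<Longrightarrow> col p = c"
  shows "card (alternations S col) \<le> 2 * card D"
  using card_alternations_le[OF fin inj D, of "{}" col "\<lambda>_. c"] col by simp

lemma alternations_mono:
  assumes "S' = {p \<in> S. c \<le> snd p \<and> snd p \<le> d}"
  shows "alternations S' col \<subseteq> alternations S col"
  unfolding assms alternations_def by force

section \<open>Reduction of guillotine cuts to cuts of whole strips\<close>

lemma split_cost_VL: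
  "split_cost X (VL k) (a, b, c, d) =
     card (alternations {p \<in> strip X a b. c \<le> snd p \<and> snd p \<le> d} (\<lambda>p. fst p \<le> k))"
proof -
  have "{p \<in> strip X a b. c \<le> snd p \<and> snd p \<le> d} = {p \<in> X. in_rect (a, b, c, d) p}"
    by (auto simp: strip_def in_rect_def)
  then show ?thesis by (simp only: split_cost_def alternations_def Let_def gline.case)
qed

text \<open>Reflection in the diagonal turns horizontal cuts into vertical ones, so that only
  vertical strips have to be analysed.\<close>

lemma split_cost_HL:
  "split_cost X (HL k) (a, b, c, d) = split_cost (prod.swap ` X) (VL k) (c, d, a, b)"
proof -
  define Q where "Q = {p \<in> X. in_rect (a, b, c, d) p}"
  let ?s = "map_prod prod.swap prod.swap :: point \<times> point \<Rightarrow> _"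
  let ?H = "{(p, q). p \<in> Q \<and> q \<in> Q \<and> fst p < fst q
    \<and> \<not> (\<exists>r\<in>Q. fst p < fst r \<and> fst r < fst q) \<and> ((snd p \<le> k) \<noteq> (snd q \<le> k))}"
  have "{p \<in> prod.swap ` X. in_rect (c, d, a, b) p} = prod.swap ` Q"
    by (auto simp: Q_def in_rect_def)
  then have "split_cost (prod.swap ` X) (VL k) (c, d, a, b)
      = card {(p, q). p \<in> prod.swap ` Q \<and> q \<in> prod.swap ` Q \<and> snd p < snd q
        \<and> \<not> (\<exists>r\<in>prod.swap ` Q. snd p < snd r \<and> snd r < snd q) \<and> ((fst p \<le> k) \<noteq> (fst q \<le> k))}"
    by (simp only: split_cost_def Let_def gline.case)
  also have "\<dots> = card (?s ` ?H)"
    by (rule arg_cong[of _ _ card]) (force simp: image_iff set_eq_iff)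
  also have "\<dots> = card ?H"
    by (rule card_image) (auto simp: inj_on_def)
  also have "\<dots> = split_cost X (HL k) (a, b, c, d)"
    by (simp only: split_cost_def Let_def gline.case Q_def)
  finally show ?thesis by simp
qed

definition interval_family :: "int \<Rightarrow> (int \<times> int) set \<Rightarrow> bool" where
  "interval_family m A \<longleftrightarrow> finite A \<and> (\<forall>(a, b)\<in>A. 1 \<le> a \<and> a \<le> b \<and> b \<le> m)
     \<and> (\<forall>(a, b)\<in>A. \<forall>(a', b')\<in>A. (a, b) \<noteq> (a', b') \<longrightarrow> b < a' \<or> b' < a)"

definition split_intervals :: "int \<Rightarrow> (int \<times> int) set \<Rightarrow> (int \<times> int) set" where
  "split_intervals k A = {(a, b) \<in> A. \<not> (a \<le> k \<and> k < b)}
     \<union> (\<Union>(a, b) \<in> {(a, b) \<in> A. a \<le> k \<and> k < b}. {(a, k), (k + 1, b)})"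

definition grid :: "(int \<times> int) set \<Rightarrow> (int \<times> int) set \<Rightarrow> rect set" where
  "grid A B = {(a, b, c, d). (a, b) \<in> A \<and> (c, d) \<in> B}"

text \<open>A line cuts every rectangle it meets, and whether a vertical line meets a rectangle
  depends only on the horizontal side. Hence the partition never loses its product form.\<close>

lemma split_all_grid_VL: "split_all (VL k) (grid A B) = grid (split_intervals k A) B"
  unfolding split_all_def grid_def split_intervals_def crosses_def
  by (auto split: prod.splits; force)

lemma split_all_grid_HL: "split_all (HL k) (grid A B) = grid A (split_intervals k B)"
  unfolding split_all_def grid_def split_intervals_def crosses_def
  by (auto split: prod.splits; force)

text \<open>By disjointness at most one interval has \<open>k\<close> inside. The freshness facts of
  the second case allow sums over the new family to be expanded.\<close>

lemma split_intervals_cases: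
  assumes "interval_family m A"
  obtains "{(a, b) \<in> A. a \<le> k \<and> k < b} = {}" "split_intervals k A = A"
  | a b A' where "A = insert (a, b) A'" "(a, b) \<notin> A'" "1 \<le> a" "a \<le> k" "k < b" "b \<le> m"
      "{(a, b) \<in> A. a \<le> k \<and> k < b} = {(a, b)}"
      "split_intervals k A = insert (a, k) (insert (k + 1, b) A')"
      "(a, k) \<notin> A'" "(k + 1, b) \<notin> A'" "finite A'"
proof (cases "{(a, b) \<in> A. a \<le> k \<and> k < b} = {}")
  case True
  then show ?thesis using that(1) unfolding split_intervals_def by fastforce
next
  case False
  then obtain a b where ab: "(a, b) \<in> A" "a \<le> k" "k < b" by auto
  have dis: "b' < a \<or> b < a'" if "(a', b') \<in> A" "(a', b') \<noteq> (a, b)" for a' b'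
    using that ab(1) assms unfolding interval_family_def by fastforce
  have 1: "{(a, b) \<in> A. a \<le> k \<and> k < b} = {(a, b)}"
    using ab dis by fastforce
  have ne: "(a', b') \<in> A \<Longrightarrow> a' \<le> b'" for a' b' using assms unfolding interval_family_def by auto
  show ?thesis
  proof (rule that(2)[of a b "A - {(a, b)}"])
    show "split_intervals k A = insert (a, k) (insert (k + 1, b) (A - {(a, b)}))"
      unfolding split_intervals_def 1 using dis ab by fastforce
    show "(a, k) \<notin> A - {(a, b)}" "(k + 1, b) \<notin> A - {(a, b)}"
      using dis[of a k] dis[of "k + 1" b] ab by auto
  qed (use ab 1 assms in \<open>auto simp: interval_family_def\<close>)
qed

lemma interval_family_split:
  assumes "interval_family m A"
  shows "interval_family m (split_intervals k A)"
  using assms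
proof (cases rule: split_intervals_cases[of m A k])
  case (2 a b A')
  have dis: "b' < a \<or> b < a'" if "(a', b') \<in> A'" for a' b'
    using that assms 2(1,2) unfolding interval_family_def by fastforce
  then show ?thesis using assms unfolding 2(8) using 2(1,3-6)
    unfolding interval_family_def by (auto; fastforce)
qed (use assms in simp)

lemma sum_split_cost_VL_le:
  assumes X: "finite X" and B: "interval_family m B"
  shows "(\<Sum>(c, d)\<in>B. split_cost X (VL k) (a, b, c, d)) \<le> strip_cost X a b k"
proof -
  let ?al = "\<lambda>(c, d). alternations {p \<in> strip X a b. c \<le> snd p \<and> snd p \<le> d} (\<lambda>p. fst p \<le> k)"
  have fS: "finite (strip X a b)" using X by (simp add: strip_def)
  have "(\<Sum>(c, d)\<in>B. split_cost X (VL k) (a, b, c, d)) = (\<Sum>J\<in>B. card (?al J))"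
    by (simp add: split_cost_VL case_prod_beta)
  also have "\<dots> = card (\<Union>J\<in>B. ?al J)"
  proof (rule card_UN_disjoint[symmetric])
    show "finite B" using B by (simp add: interval_family_def)
    show "\<forall>J\<in>B. finite (?al J)" using fS by (auto intro!: finite_alternations)
    show "\<forall>J\<in>B. \<forall>J'\<in>B. J \<noteq> J' \<longrightarrow> ?al J \<inter> ?al J' = {}"
      using B unfolding interval_family_def alternations_def by fastforce
  qed
  also have "\<dots> \<le> strip_cost X a b k"
    unfolding strip_cost_def
  proof (rule card_mono)
    show "(\<Union>J\<in>B. ?al J) \<subseteq> alternations (strip X a b) (\<lambda>p. fst p \<le> k)"
      using alternations_mono[OF refl] by (force simp: case_prod_beta)
  qed (intro finite_alternations fS)
  finally show ?thesis .
qed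

text \<open>Consecutive points of a rectangle are consecutive in the whole strip, so in a product
  partition the vertical cuts and the horizontal cuts can be paid for separately.\<close>

lemma cGB_run_le:
  fixes \<Phi> \<Psi> :: "int \<Rightarrow> int \<Rightarrow> real"
  assumes X: "finite X"
    and \<Phi>: "\<And>a b k. 1 \<le> a \<Longrightarrow> a \<le> k \<Longrightarrow> k < b \<Longrightarrow> b \<le> m \<Longrightarrow>
      real (strip_cost X a b k) + \<Phi> a k + \<Phi> (k + 1) b \<le> \<Phi> a b"
    and \<Psi>: "\<And>a b k. 1 \<le> a \<Longrightarrow> a \<le> k \<Longrightarrow> k < b \<Longrightarrow> b \<le> m \<Longrightarrow>
      real (strip_cost (prod.swap ` X) a b k) + \<Psi> a k + \<Psi> (k + 1) b \<le> \<Psi> a b"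
    and \<Phi>0: "\<And>a b. 1 \<le> a \<Longrightarrow> a \<le> b \<Longrightarrow> b \<le> m \<Longrightarrow> 0 \<le> \<Phi> a b"
    and \<Psi>0: "\<And>a b. 1 \<le> a \<Longrightarrow> a \<le> b \<Longrightarrow> b \<le> m \<Longrightarrow> 0 \<le> \<Psi> a b"
  assumes "interval_family m A" "interval_family m B"
  shows "real (cGB_run X (grid A B) \<sigma>) \<le> (\<Sum>(a, b)\<in>A. \<Phi> a b) + (\<Sum>(c, d)\<in>B. \<Psi> c d)"
  using assms(6,7)
proof (induction \<sigma> arbitrary: A B)
  case Nil
  then show ?case using \<Phi>0 \<Psi>0
    by (auto simp: interval_family_def intro!: add_nonneg_nonneg sum_nonneg)
next
  case (Cons L \<sigma>)
  note A = Cons.prems(1) and B = Cons.prems(2)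
  show ?case
  proof (cases L)
    case (VL k)
    have IH: "real (cGB_run X (split_all L (grid A B)) \<sigma>)
        \<le> (\<Sum>(a, b)\<in>split_intervals k A. \<Phi> a b) + (\<Sum>(c, d)\<in>B. \<Psi> c d)"
      unfolding VL split_all_grid_VL by (intro Cons.IH interval_family_split A B)
    show ?thesis using A
    proof (cases rule: split_intervals_cases[of m A k])
      case 1
      then have none: "{R \<in> grid A B. crosses L R} = {}"
        unfolding VL grid_def crosses_def by force
      show ?thesis using IH unfolding cGB_run.simps none 1(2) by simp
    next
      case (2 a b A')
      \<comment> \<open>Exactly the rectangles over \<open>(a, b)\<close> are cut, one for each
        member of \<open>B\<close>. Together they cost at most one cut of the strip, and
        \<open>\<Phi>\<close> pays for that.\<close>
      have "{R \<in> grid A B. crosses L R} = (\<lambda>(c, d). (a, b, c, d)) ` B"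
        using 2(4,5,7) unfolding VL grid_def crosses_def set_eq_iff by (force simp: image_iff)
      then have "(\<Sum>R \<in> {R \<in> grid A B. crosses L R}. split_cost X L R)
          = (\<Sum>(c, d)\<in>B. split_cost X (VL k) (a, b, c, d))"
        by (simp add: sum.reindex inj_on_def VL case_prod_beta prod_eq_iff)
      also have "\<dots> \<le> strip_cost X a b k" using X B by (rule sum_split_cost_VL_le)
      finally have "real (\<Sum>R \<in> {R \<in> grid A B. crosses L R}. split_cost X L R) + \<Phi> a k + \<Phi> (k + 1) b \<le> \<Phi> a b"
        using \<Phi>[of a k b] 2 by linarith
      then show ?thesis using IH 2 unfolding 2(8) by (simp add: 2(1))
    qed
  next
    case (HL k)
    have IH: "real (cGB_run X (split_all L (grid A B)) \<sigma>)
        \<le> (\<Sum>(a, b)\<in>A. \<Phi> a b) + (\<Sum>(c, d)\<in>split_intervals k B. \<Psi> c d)"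
      unfolding HL split_all_grid_HL by (intro Cons.IH interval_family_split A B)
    show ?thesis using B
    proof (cases rule: split_intervals_cases[of m B k])
      case 1
      then have none: "{R \<in> grid A B. crosses L R} = {}"
        unfolding HL grid_def crosses_def by force
      show ?thesis using IH unfolding cGB_run.simps none 1(2) by simp
    next
      case (2 c d B')
      have "{R \<in> grid A B. crosses L R} = (\<lambda>(a, b). (a, b, c, d)) ` A"
        using 2(4,5,7) unfolding HL grid_def crosses_def set_eq_iff by (force simp: image_iff)
      then have "(\<Sum>R \<in> {R \<in> grid A B. crosses L R}. split_cost X L R)
          = (\<Sum>(a, b)\<in>A. split_cost (prod.swap ` X) (VL k) (c, d, a, b))"
        by (simp add: sum.reindex inj_on_def HL case_prod_beta prod_eq_iff split_cost_HL)
      also have "\<dots> \<le> strip_cost (prod.swap ` X) c d k"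
        using X A by (intro sum_split_cost_VL_le) auto
      finally have "real (\<Sum>R \<in> {R \<in> grid A B. crosses L R}. split_cost X L R) + \<Psi> c k + \<Psi> (k + 1) d \<le> \<Psi> c d"
        using \<Psi>[of c k d] 2 by linarith
      then show ?thesis using IH 2 unfolding 2(8) by (simp add: 2(1))
    qed
  qed
qed

section \<open>Lower bounds for satisfied sets from horizontal gaps\<close>

text \<open>Among the pairs of \<open>S\<close> in the box that straddle column \<open>k\<close>,
  one at least L1 distance has no further point of \<open>S\<close> in its own box. Satisfaction
  then makes the two points collinear, and as they lie on different sides of \<open>k\<close>, they
  share a row.\<close>

lemma satisfied_gap:
  assumes S: "satisfied S" and p: "p \<in> S" "fst p < k" and q: "q \<in> S" "k \<le> fst q"
  obtains u v where "u \<in> S" "v \<in> S" "u \<in> box p q" "v \<in> box p q" "snd u = snd v"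
    "fst u < k" "k \<le> fst v" "\<And>r. r \<in> S \<Longrightarrow> snd r = snd u \<Longrightarrow> \<not> (fst u < fst r \<and> fst r < fst v)"
proof -
  define P where "P = (\<lambda>(u, v). u \<in> S \<and> v \<in> S \<and> u \<in> box p q \<and> v \<in> box p q \<and> fst u < k \<and> k \<le> fst v)"
  define d :: "point \<times> point \<Rightarrow> nat"
    where "d = (\<lambda>(u, v). nat (\<bar>fst v - fst u\<bar> + \<bar>snd v - snd u\<bar>))"
  have "P (p, q)" using p q by (auto simp: P_def box_def)
  then obtain e where "P e" and min: "\<And>e'. P e' \<Longrightarrow> d e \<le> d e'"
    using ex_has_least_nat[of P "(p, q)" d] by blast
  obtain u v where e: "e = (u, v)" by (cases e)
  note uv = \<open>P e\<close>[unfolded e P_def prod.case]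
  have box: "r \<in> box p q" if "r \<in> box u v" for r
    using that uv unfolding box_def by auto
  have no: "r \<notin> box u v" if r: "r \<in> S" "r \<noteq> u" "r \<noteq> v" for r
  proof
    assume rb: "r \<in> box u v"
    \<comment> \<open>A point of the small box can replace the end on its own side of
      \<open>k\<close>, which gives a closer pair.\<close>
    have "P (r, v) \<or> P (u, r)" using uv r box[OF rb] by (auto simp: P_def)
    moreover have "d (r, v) < d (u, v)" "d (u, r) < d (u, v)"
    proof -
      have "fst u \<le> fst r" "fst r \<le> fst v" using rb uv by (auto simp: box_def)
      moreover have "\<bar>snd v - snd r\<bar> + \<bar>snd r - snd u\<bar> = \<bar>snd v - snd u\<bar>"
        using rb unfolding box_def mem_Collect_eq by linarith
      moreover have "fst r \<noteq> fst u \<or> snd r \<noteq> snd u" "fst r \<noteq> fst v \<or> snd r \<noteq> snd v"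
        using r by (auto simp: prod_eq_iff)
      moreover have "fst u < fst v" using uv by simp
      ultimately have "\<bar>fst v - fst r\<bar> + \<bar>snd v - snd r\<bar> < \<bar>fst v - fst u\<bar> + \<bar>snd v - snd u\<bar>"
        "\<bar>fst r - fst u\<bar> + \<bar>snd r - snd u\<bar> < \<bar>fst v - fst u\<bar> + \<bar>snd v - snd u\<bar>"
        by (smt (verit), smt (verit))
      then show "d (r, v) < d (u, v)" "d (u, r) < d (u, v)"
        unfolding d_def prod.case using \<open>fst u < fst v\<close> by (simp_all only: nat_less_iff nat_mono_iff abs_ge_zero add_pos_nonneg zero_less_abs_iff)
    qed
    ultimately show False using min e by fastforce
  qed
  show ?thesis
  proof (rule that)
    show same: "snd u = snd v"
    proof (rule ccontr)
      assume "snd u \<noteq> snd v"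
      then have "\<not> collinear u v" using uv by (auto simp: collinear_def)
      with S uv no show False unfolding satisfied_def pair_satisfied_def by blast
    qed
    show "\<not> (fst u < fst r \<and> fst r < fst v)" if "r \<in> S" "snd r = snd u" for r
    proof
      assume "fst u < fst r \<and> fst r < fst v"
      moreover from this have "r \<noteq> u" "r \<noteq> v" by auto
      ultimately show False using no[of r] that same by (simp add: box_def)
    qed
  qed (use uv in auto)
qed

text \<open>The gaps of \<open>S\<close>, pairs of horizontally adjacent points of \<open>S\<close>, are at most as many
  as its points; so it suffices to assign disjoint sets of gaps to the demands \<open>f\<close>.\<close>

lemma card_demands_le:
  assumes S: "satisfied S" "finite S"
    and f: "\<And>f. f \<in> F \<Longrightarrow> P f \<in> S \<and> Q f \<in> S \<and> fst (P f) < K f \<and> K f \<le> fst (Q f)"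
    and disj: "\<And>f g u v. f \<in> F \<Longrightarrow> g \<in> F \<Longrightarrow> u \<in> box (P f) (Q f) \<Longrightarrow> v \<in> box (P f) (Q f) \<Longrightarrow>
      u \<in> box (P g) (Q g) \<Longrightarrow> v \<in> box (P g) (Q g) \<Longrightarrow> snd u = snd v \<Longrightarrow>
      fst u < K f \<Longrightarrow> K f \<le> fst v \<Longrightarrow> fst u < K g \<Longrightarrow> K g \<le> fst v \<Longrightarrow> f = g"
  shows "card F \<le> card S"
proof -
  define gap where "gap = (\<lambda>f u v. u \<in> S \<and> v \<in> S \<and> u \<in> box (P f) (Q f) \<and> v \<in> box (P f) (Q f) \<and>
    snd u = snd v \<and> fst u < K f \<and> K f \<le> fst v \<and> (\<forall>r\<in>S. snd r = snd u \<longrightarrow> \<not> (fst u < fst r \<and> fst r < fst v)))"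
  have ex: "\<exists>u. \<exists>v. gap f u v" if "f \<in> F" for f
    using satisfied_gap[OF S(1), of "P f" "K f" "Q f"] f[OF that] unfolding gap_def by metis
  define L where "L = (\<lambda>f. SOME u. \<exists>v. gap f u v)"
  have L: "\<exists>v. gap f (L f) v" if "f \<in> F" for f
    unfolding L_def using someI_ex[OF ex[OF that]] .
  have "inj_on L F"
  proof (rule inj_onI)
    fix f g assume fg: "f \<in> F" "g \<in> F" "L f = L g"
    obtain v w where v: "gap f (L f) v" and w: "gap g (L f) w" using L fg by metis
    \<comment> \<open>Two gaps with the same left end have the same right end, since neither has a
      point of \<open>S\<close> in its interior.\<close>
    have "v = w" using v w unfolding gap_def by (auto simp: prod_eq_iff not_less intro!: antisym)
    with disj[OF fg(1,2), of "L f" v] v w show "f = g" by (auto simp: gap_def)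
  qed
  moreover have "L ` F \<subseteq> S" using L by (auto simp: gap_def)
  ultimately show ?thesis using S(2) by (rule card_inj_on_le)
qed

text \<open>A full grid contains the corners of all boxes and is satisfied, so the minimum in
  \<open>opt\<close> ranges over a nonempty set and is attained.\<close>

lemma opt_witness:
  assumes "finite X" "X \<subseteq> {a..b} \<times> {c..d}"
  obtains Y where "finite Y" "card Y = opt X" "satisfied (X \<union> Y)"
proof -
  let ?G = "{a..b} \<times> {c..d}"
  have "X \<union> ?G = ?G" using assms by auto
  moreover have "satisfied ?G"
    unfolding satisfied_def
  proof (intro ballI impI)
    fix p q assume "p \<in> ?G" "q \<in> ?G" "\<not> collinear p q"
    then show "pair_satisfied ?G p q" unfolding pair_satisfied_def
      by (intro bexI[of _ "(fst p, snd q)"]) (auto simp: box_def collinear_def)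
  qed
  ultimately have "\<exists>k Y. finite Y \<and> card Y = k \<and> satisfied (X \<union> Y)"
    by (metis finite_SigmaI finite_atLeastAtMost_int)
  then have "\<exists>Y. finite Y \<and> card Y = opt X \<and> satisfied (X \<union> Y)"
    unfolding opt_def by (rule LeastI_ex)
  with that show ?thesis by blast
qed

section \<open>Bit reversal and dyadic blocks\<close>

fun bitrev :: "nat \<Rightarrow> nat \<Rightarrow> nat" where
  "bitrev 0 i = 0"
| "bitrev (Suc l) i = 2 ^ l * (i mod 2) + bitrev l (i div 2)"

lemma bitrev_less: "bitrev l i < 2 ^ l"
proof (induction l arbitrary: i)
  case (Suc l)
  have "2 ^ l * (i mod 2) \<le> 2 ^ l * 1" by (intro mult_le_mono2) linarith
  with Suc[of "i div 2"] show ?case unfolding bitrev.simps power_Suc by linarith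
qed simp

lemma inj_on_bitrev: "inj_on (bitrev l) {..<2 ^ l}"
proof (induction l)
  case (Suc l)
  show ?case
  proof (rule inj_onI)
    fix i j assume ij: "i \<in> {..<2 ^ Suc l}" "j \<in> {..<2 ^ Suc l}" "bitrev (Suc l) i = bitrev (Suc l) j"
    have "bitrev (Suc l) i div 2 ^ l = i mod 2" "bitrev (Suc l) i mod 2 ^ l = bitrev l (i div 2)" for i
      using bitrev_less[of l] by simp_all
    with ij(3) have "i mod 2 = j mod 2" "bitrev l (i div 2) = bitrev l (j div 2)" by metis+
    moreover from this(2) have "i div 2 = j div 2"
      using inj_onD[OF Suc, of "i div 2" "j div 2"] ij by auto
    ultimately show "i = j" by (metis div_mult_mod_eq)
  qed
qed (simp add: inj_on_def)

lemma bij_betw_bitrev: "bij_betw (bitrev l) {..<2 ^ l} {..<2 ^ l}"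
proof (rule bij_betw_imageI[OF inj_on_bitrev])
  show "bitrev l ` {..<2 ^ l} = {..<2 ^ l}"
    by (rule endo_inj_surj[OF _ _ inj_on_bitrev]) (use bitrev_less in auto)
qed

text \<open>The bits of \<open>i\<close> from position \<open>q\<close> upwards become the lowest
  \<open>l - q\<close> bits of the reversal.\<close>

lemma bitrev_cong:
  assumes "i div 2 ^ q = j div 2 ^ q" "q \<le> l"
  shows "bitrev l i mod 2 ^ (l - q) = bitrev l j mod 2 ^ (l - q)"
  using assms
proof (induction l arbitrary: i j q)
  case (Suc l)
  show ?case
  proof (cases q)
    case 0
    with Suc.prems show ?thesis by simp
  next
    case (Suc q')
    have "(2 :: nat) ^ (l - q') dvd 2 ^ l" by (simp add: le_imp_power_dvd)
    then obtain c where c: "(2 :: nat) ^ l = 2 ^ (l - q') * c" ..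
    have "bitrev (Suc l) i mod 2 ^ (l - q') = bitrev l (i div 2) mod 2 ^ (l - q')" for i
      unfolding bitrev.simps c by (simp add: mult.assoc)
    with Suc.IH[of "i div 2" q' "j div 2"] Suc.prems show ?thesis
      unfolding Suc by (simp add: div_mult2_eq)
  qed
qed simp

text \<open>Adding \<open>2 ^ q\<close> sets bit \<open>q\<close>, which is clear by assumption; in
  the reversal this is bit \<open>l - 1 - q\<close>.\<close>

lemma bitrev_add:
  assumes "even (i div 2 ^ q)" "q < l"
  shows "bitrev l (i + 2 ^ q) = bitrev l i + 2 ^ (l - 1 - q)"
  using assms
proof (induction l arbitrary: i q)
  case (Suc l)
  show ?case
  proof (cases q)
    case 0
    with Suc.prems show ?thesis by (simp add: mod2_eq_if)
  next
    case (Suc q')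
    have "(i + 2 ^ q) div 2 = i div 2 + 2 ^ q'" "(i + 2 ^ q) mod 2 = i mod 2"
      unfolding Suc by simp_all
    moreover have "even (i div 2 div 2 ^ q')" "q' < l" "l - 1 - q' = l - q"
      using Suc.prems unfolding Suc by (simp_all add: div_mult2_eq)
    ultimately show ?thesis
      using Suc.IH[of "i div 2" q'] by (simp only: bitrev.simps diff_Suc_1)
  qed
qed simp

text \<open>\<open>i\<close> and \<open>i + 2 ^ q\<close> lie in the same aligned block of length
  \<open>2 ^ (q + 1)\<close>. A multiple of the higher power \<open>2 ^ q'\<close> is a boundary of
  such blocks, so it cannot separate the two.\<close>

lemma dyadic_disjoint:
  fixes i q q' c :: nat
  assumes "even (i div 2 ^ q)" "q < q'" "i < c * 2 ^ q'"
  shows "i + 2 ^ q < c * 2 ^ q'"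
proof -
  define D :: nat where "D = 2 ^ q"
  have "2 dvd i div D" using assms(1) by (simp add: D_def)
  then obtain b where b: "i div D = 2 * b" ..
  have "(2 :: nat) ^ q' = 2 * D * 2 ^ (q' - Suc q)"
    using assms(2) by (simp add: D_def flip: power_Suc power_add)
  then obtain e where e: "c * 2 ^ q' = e * (2 * D)" by (metis mult.commute mult.assoc)
  have i: "i = b * (2 * D) + i mod D" by (metis b div_mult_mod_eq mult.assoc mult.commute)
  then have "b * (2 * D) < e * (2 * D)" using assms(3) e by linarith
  then have "b + 1 \<le> e" by simp
  then have "(b + 1) * (2 * D) \<le> e * (2 * D)" by (rule mult_right_mono) simp
  moreover have "i mod D < D" by (simp add: D_def)
  ultimately show ?thesis using i unfolding e D_def[symmetric] by simp
qed

lemma card_even_digit: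
  assumes "q < l"
  shows "card {i :: nat. i < 2 ^ l \<and> even (i div 2 ^ q)} * 2 = 2 ^ l"
proof -
  let ?E = "{i :: nat. i < 2 ^ l \<and> even (i div 2 ^ q)}" and ?O = "{i :: nat. i < 2 ^ l \<and> odd (i div 2 ^ q)}"
  have up: "i + 2 ^ q < 2 ^ l" if "i \<in> ?E" for i
    using dyadic_disjoint[of i q l 1] assms that by simp
  have "bij_betw (\<lambda>i. i + 2 ^ q) ?E ?O"
  proof (rule bij_betw_byWitness[where f' = "\<lambda>i. i - 2 ^ q"])
    have ge: "2 ^ q \<le> i" if "odd (i div 2 ^ q)" for i :: nat
      using that by (metis div_less even_zero not_le)
    show "\<forall>i\<in>?O. i - 2 ^ q + 2 ^ q = i" using ge by simp
    show "(\<lambda>i. i - 2 ^ q) ` ?O \<subseteq> ?E"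
    proof clarify
      fix i :: nat assume i: "i < 2 ^ l" "odd (i div 2 ^ q)"
      have "(i - 2 ^ q + 2 ^ q) div 2 ^ q = (i - 2 ^ q) div 2 ^ q + 1" by simp
      with i ge[of i] show "i - 2 ^ q < 2 ^ l \<and> even ((i - 2 ^ q) div 2 ^ q)" by auto
    qed
  qed (use up in auto)
  then have "card ?E = card ?O" by (rule bij_betw_same_card)
  moreover have "card (?E \<union> ?O) = card ?E + card ?O" by (rule card_Un_disjoint) auto
  moreover have "?E \<union> ?O = {..<2 ^ l}" by auto
  ultimately show ?thesis by simp
qed

lemma int_div_less:
  fixes x b c :: int
  assumes "0 < b" "x < c * b"
  shows "x div b < c"
proof -
  have "x div b * b \<le> x" using assms(1) by (simp add: minus_mod_eq_div_mult[symmetric])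
  then have "x div b * b < c * b" using assms(2) by linarith
  then show ?thesis using assms(1) by simp
qed

lemma mod_eq_close:
  fixes a b d :: nat
  assumes "a mod (2 * d) = b mod (2 * d)" "a \<le> b + d" "b \<le> a + d" "0 < d"
  shows "a = b"
proof -
  have "a = b" if "a mod (2 * d) = b mod (2 * d)" "a \<le> b" "b \<le> a + d" for a b
  proof (rule ccontr)
    assume "a \<noteq> b"
    moreover have "2 * d dvd b - a" using that mod_eq_dvd_iff_nat[of a b "2 * d"] by simp
    ultimately show False using that assms(4) dvd_imp_le[of "2 * d" "b - a"] by linarith
  qed
  from this[of a b] this[of b a] assms show ?thesis by (cases "a \<le> b") auto
qed

section \<open>The array of shifted permutations\<close>

locale shift_grid =
  fixes n :: nat and \<pi> :: "nat \<Rightarrow> nat"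
  assumes n: "0 < n" and \<pi>: "bij_betw \<pi> {..<n} {..<n}"
begin

text \<open>Coordinates run from \<open>0\<close> to \<open>T - 1\<close> and have three digits,
  \<open>hi\<close> and \<open>mid\<close> in base \<open>N\<close> and \<open>lo\<close> in base
  \<open>n\<close>. For a column, \<open>hi\<close> names the cell, \<open>mid\<close> is the
  shifted exponential position, and \<open>lo\<close> is the exponent, which keeps columns apart
  when positions coincide.\<close>

definition N :: int where "N = 2 ^ n"
definition T :: int where "T = N * N * int n"
definition hi :: "int \<Rightarrow> int" where "hi x = x div (N * int n)"
definition mid :: "int \<Rightarrow> int" where "mid x = x div int n mod N"
definition lo :: "int \<Rightarrow> nat" where "lo x = nat (x mod int n)"
definition enc :: "int \<Rightarrow> int \<Rightarrow> nat \<Rightarrow> int" where "enc a b i = (a * N + b) * int n + int i"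

definition rel :: "int \<Rightarrow> int \<Rightarrow> bool" where
  "rel x y \<longleftrightarrow> 0 \<le> x \<and> x < T \<and> 0 \<le> y \<and> y < T \<and> lo y = \<pi> (lo x)
     \<and> mid x = (hi y + 2 ^ lo x) mod N \<and> mid y = (hi x + 2 ^ lo y) mod N"

text \<open>The points whose column has upper digit \<open>t\<close> and whose row has upper digit \<open>s\<close> form
  an exponentially spaced copy of the permutation \<open>\<pi>\<close>, shifted cyclically by \<open>s\<close>
  horizontally and by \<open>t\<close> vertically.\<close>

definition pts :: "point set" where "pts = {(x + 1, y + 1) | x y. rel x y}"

lemma N_pos: "0 < N" by (simp add: N_def)
lemma power_less_N: "i < n \<Longrightarrow> 2 ^ i < N" by (simp add: N_def)
lemma power_le_half: "i < n \<Longrightarrow> 2 * 2 ^ i \<le> N"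
  unfolding N_def using power_increasing[of "Suc i" n "2 :: int"] by simp

lemma hi_eq: "hi x = x div int n div N"
  using zdiv_zmult2_eq[of N x "int n"] N_pos unfolding hi_def by (metis less_imp_le mult.commute)

lemma enc:
  assumes "0 \<le> a" "a < N" "0 \<le> b" "b < N" "i < n"
  shows "hi (enc a b i) = a" "mid (enc a b i) = b" "lo (enc a b i) = i" "0 \<le> enc a b i" "enc a b i < T"
proof -
  have 1: "enc a b i div int n = a * N + b" "enc a b i mod int n = int i"
    unfolding enc_def using assms by (simp_all add: div_pos_pos_trivial)
  have "(a * N + b) div N = a" "(a * N + b) mod N = b" using assms by (simp_all add: div_pos_pos_trivial)
  then show h: "hi (enc a b i) = a" "mid (enc a b i) = b" "lo (enc a b i) = i"
    using 1 by (simp_all add: hi_eq mid_def lo_def)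
  show "0 \<le> enc a b i" using assms N_pos by (simp add: enc_def)
  have "a * N + b + 1 \<le> (N - 1) * N + N" using assms mult_right_mono[of a "N - 1" N] by linarith
  then have "(a * N + b + 1) * int n \<le> (N * N) * int n" by (intro mult_right_mono) (auto simp: algebra_simps)
  then show "enc a b i < T" using assms by (simp add: enc_def T_def algebra_simps)
qed

lemma digits:
  assumes "0 \<le> x" "x < T"
  shows "enc (hi x) (mid x) (lo x) = x" "0 \<le> hi x" "hi x < N" "0 \<le> mid x" "mid x < N" "lo x < n"
proof -
  have "int (lo x) = x mod int n" using n by (simp add: lo_def)
  then show "enc (hi x) (mid x) (lo x) = x" "lo x < n"
    using n unfolding enc_def hi_eq mid_def by (simp_all add: lo_def nat_less_iff)
  show "0 \<le> hi x" using assms N_pos by (simp add: hi_def pos_imp_zdiv_nonneg_iff n)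
  have "x div int n < N * N" using assms n by (intro int_div_less) (auto simp: T_def)
  then show "hi x < N" unfolding hi_eq using N_pos by (rule int_div_less[rotated])
  show "0 \<le> mid x" "mid x < N" using N_pos by (simp_all add: mid_def)
qed

lemma hi_mono: "x \<le> y \<Longrightarrow> hi x \<le> hi y"
  unfolding hi_def by (intro zdiv_mono1) (use n N_pos in auto)

lemma \<pi>_less: "i < n \<Longrightarrow> \<pi> i < n"
  using \<pi> by (auto simp: bij_betw_def)

text \<open>The equation for \<open>mid x\<close> determines \<open>hi y\<close> modulo
  \<open>N\<close>, and the other two digits of \<open>y\<close> are given explicitly. Solving the
  same equations yields \<open>rel_exists\<close>.\<close>

lemma rel_unique:
  assumes "rel x y" "rel x y'"
  shows "y = y'"
proof -
  have "(hi y + 2 ^ lo x) mod N = (hi y' + 2 ^ lo x) mod N" "lo y = lo y'"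
    "mid y = mid y'" using assms by (simp_all add: rel_def)
  then have "hi y mod N = hi y' mod N" by (metis add_diff_cancel_right' mod_diff_cong)
  then have "hi y = hi y'" using digits[of y] digits[of y'] assms by (simp add: rel_def)
  with digits(1)[of y] digits(1)[of y'] show ?thesis
    using assms \<open>lo y = lo y'\<close> \<open>mid y = mid y'\<close> by (simp add: rel_def)
qed

lemma rel_exists:
  assumes "0 \<le> x" "x < T"
  shows "\<exists>y. rel x y"
proof
  note d = digits[OF assms]
  let ?y = "enc ((mid x - 2 ^ lo x) mod N) ((hi x + 2 ^ \<pi> (lo x)) mod N) (\<pi> (lo x))"
  have "hi ?y = (mid x - 2 ^ lo x) mod N" "mid ?y = (hi x + 2 ^ \<pi> (lo x)) mod N" "lo ?y = \<pi> (lo x)"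
    "0 \<le> ?y" "?y < T"
    using enc[of "(mid x - 2 ^ lo x) mod N" "(hi x + 2 ^ \<pi> (lo x)) mod N" "\<pi> (lo x)"] d N_pos \<pi>_less by auto
  then show "rel x ?y" unfolding rel_def using assms d by (simp add: mod_simps)
qed

lemma inverse_shift_grid: "shift_grid n (inv_into {..<n} \<pi>)"
  using n bij_betw_inv_into[OF \<pi>] by unfold_locales

lemma rel_inverse: "shift_grid.rel n (inv_into {..<n} \<pi>) y x \<longleftrightarrow> rel x y"
proof -
  have "lo x = inv_into {..<n} \<pi> (lo y) \<longleftrightarrow> lo y = \<pi> (lo x)"
    if "0 \<le> x" "x < T" "0 \<le> y" "y < T"
    using \<pi> digits(6)[of x] digits(6)[of y] that
    by (metis bij_betw_inv_into_left bij_betw_inv_into_right lessThan_iff)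
  then show ?thesis
    unfolding shift_grid.rel_def[OF inverse_shift_grid] rel_def by auto
qed

text \<open>Transposition exchanges the two shifts and inverts \<open>\<pi>\<close>. This is why the
  locale admits an arbitrary permutation: facts on columns and vertical cuts carry over to rows and
  horizontal cuts.\<close>

lemma pts_inverse: "shift_grid.pts n (inv_into {..<n} \<pi>) = prod.swap ` pts"
  unfolding shift_grid.pts_def[OF inverse_shift_grid] pts_def rel_inverse by auto

lemma fst_pts: "fst ` pts = {1..T}"
proof -
  have "x \<in> fst ` pts" if "x \<in> {1..T}" for x
  proof -
    obtain y where "rel (x - 1) y" using rel_exists[of "x - 1"] \<open>x \<in> {1..T}\<close> by auto
    then have "(x - 1 + 1, y + 1) \<in> pts" unfolding pts_def by blast
    then show ?thesis by force
  qed
  moreover have "x \<in> {1..T}" if "x \<in> fst ` pts" for x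
    using that unfolding pts_def rel_def by auto
  ultimately show ?thesis by blast
qed

lemma inj_on_fst_pts: "inj_on fst pts"
  unfolding pts_def by (auto simp: inj_on_def dest: rel_unique)

lemma snd_pts: "snd ` pts = {1..T}"
  using shift_grid.fst_pts[OF inverse_shift_grid] unfolding pts_inverse image_image by simp

lemma inj_on_snd_pts: "inj_on snd pts"
  using shift_grid.inj_on_fst_pts[OF inverse_shift_grid] unfolding pts_inverse
  unfolding inj_on_def by (metis fst_swap imageI swap_swap)

lemma card_pts: "int (card pts) = T"
proof -
  have "card pts = card {1..T}" using card_image[OF inj_on_fst_pts] fst_pts by simp
  then show ?thesis using N_pos by (simp add: T_def)
qed

lemma finite_pts: "finite pts"
  using finite_imageD[OF _ inj_on_fst_pts] fst_pts by simp

lemma is_permutation_pts: "is_permutation pts"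
  using inj_on_fst_pts inj_on_snd_pts by (auto simp: is_permutation_def inj_on_def)

lemma pts_subset: "pts \<subseteq> {1..T} \<times> {1..T}"
proof
  fix p assume "p \<in> pts"
  then have "fst p \<in> fst ` pts" "snd p \<in> snd ` pts" by auto
  then show "p \<in> {1..T} \<times> {1..T}" unfolding fst_pts snd_pts by (cases p) auto
qed

text \<open>Both shifts are below \<open>N / 2\<close> and the powers are at most
  \<open>N / 2\<close>, so nothing wraps around and these cells contain \<open>\<pi>\<close> with
  its order intact.\<close>

lemma enc_mem_pts:
  assumes "0 \<le> s" "2 * s < N" "0 \<le> t" "2 * t < N" "i < n"
  shows "(1 + enc t (s + 2 ^ i) i, 1 + enc s (t + 2 ^ \<pi> i) (\<pi> i)) \<in> pts"
proof -
  have "s + 2 ^ i < N" "t + 2 ^ \<pi> i < N"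
    using power_le_half[of i] power_le_half[of "\<pi> i"] \<pi>_less[of i] assms by auto
  then have "rel (enc t (s + 2 ^ i) i) (enc s (t + 2 ^ \<pi> i) (\<pi> i))"
    unfolding rel_def using enc[of t "s + 2 ^ i" i] enc[of s "t + 2 ^ \<pi> i" "\<pi> i"] assms \<pi>_less by simp
  then show ?thesis by (auto simp: pts_def add.commute)
qed

lemma enc_power_mono:
  assumes "i < j"
  shows "enc t (s + 2 ^ i) i < enc t (s + 2 ^ j) j"
proof -
  have "(t * N + (s + 2 ^ i)) * int n \<le> (t * N + (s + 2 ^ j)) * int n"
    using assms by (intro mult_right_mono) auto
  with assms show ?thesis by (simp add: enc_def)
qed

lemma enc_power_le_iff: "enc t (s + 2 ^ i) i \<le> enc t (s + 2 ^ j) j \<longleftrightarrow> i \<le> j"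
  using enc_power_mono[of i j t s] enc_power_mono[of j i t s] by (cases i j rule: linorder_cases) auto

lemma enc_power_less_iff: "enc t (s + 2 ^ i) i < enc t (s + 2 ^ j) j \<longleftrightarrow> i < j"
  using enc_power_le_iff by (metis not_less)

end

section \<open>Disjoint demands in bit reversals\<close>

text \<open>Only one multiple of \<open>D\<close> lies above \<open>i\<close> and not above
  \<open>i + D\<close>, namely \<open>(i div D + 1) * D\<close>.\<close>

lemma dyadic_same:
  fixes i i' D :: nat
  assumes "0 < D" "i < (i' div D + 1) * D" "(i' div D + 1) * D \<le> i + D"
  shows "i div D = i' div D"
proof (rule antisym)
  show "i div D \<le> i' div D" using assms by (simp add: div_less_iff_less_mult flip: less_Suc_eq_le)
  have "i' div D * D \<le> i" using assms(3) by simp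
  then show "i' div D \<le> i div D" using assms(1) by (simp add: less_eq_div_iff_mult_less_eq)
qed

text \<open>A demand \<open>(s, t, q, i)\<close> is a cell that does not wrap, a scale, and an index
  with bit \<open>q\<close> clear. Its pair has indices \<open>i\<close> and
  \<open>i + 2 ^ q\<close>; \<open>K\<close> is the column of the first multiple of
  \<open>2 ^ q\<close> above \<open>i\<close>, the middle of an aligned block of length
  \<open>2 ^ (q + 1)\<close>. There are \<open>(N / 2) * (N / 2) * l * (n / 2)\<close> demands,
  hence the factor \<open>8\<close>.\<close>

lemma opt_pts_lower:
  fixes l :: nat
  defines "X \<equiv> shift_grid.pts (2 ^ l) (bitrev l)" and "n \<equiv> 2 ^ l"
  shows "2 ^ n * 2 ^ n * n * l \<le> 8 * (card X + opt X)"
proof -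
  interpret shift_grid n "bitrev l"
    using bij_betw_bitrev by unfold_locales (simp_all add: n_def)
  have X: "X = pts" by (simp add: X_def n_def)
  obtain Y where Y: "finite Y" "card Y = opt X" "satisfied (X \<union> Y)"
    using opt_witness[of X 1 T 1 T] finite_pts pts_subset X by metis
  define H where "H = {s. 0 \<le> s \<and> 2 * s < N}"
  define E :: "nat \<Rightarrow> nat set" where "E = (\<lambda>q. {i. i < 2 ^ l \<and> even (i div 2 ^ q)})"
  define F where "F = H \<times> H \<times> (SIGMA q:{..<l}. E q)"
  define pt where "pt = (\<lambda>s t i. (1 + enc t (s + 2 ^ i) i, 1 + enc s (t + 2 ^ bitrev l i) (bitrev l i)))"
  define P where "P = (\<lambda>(s, t, q :: nat, i). pt s t i)"
  define Q where "Q = (\<lambda>(s, t, q, i). pt s t (i + 2 ^ q))"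
  define K where "K = (\<lambda>(s, t, q, i). 1 + enc t (s + 2 ^ ((i div 2 ^ q + 1) * 2 ^ q)) ((i div 2 ^ q + 1) * 2 ^ q))"
  have up: "i + 2 ^ q < n" if "q < l" "i \<in> E q" for q i :: nat
    using dyadic_disjoint[of i q l 1] that by (simp add: E_def n_def)
  have sandwich: "i < (i div 2 ^ q + 1) * 2 ^ q" "(i div 2 ^ q + 1) * 2 ^ q \<le> i + 2 ^ q" for i q :: nat
    using dividend_less_div_times[of "2 ^ q" i] by (simp_all add: add.commute)
  have "card F \<le> card (X \<union> Y)"
  proof (rule card_demands_le[where P = P and Q = Q and K = K])
    show "satisfied (X \<union> Y)" "finite (X \<union> Y)" using Y finite_pts X by auto
  next
    fix f assume "f \<in> F"
    then obtain s t q i where f: "f = (s, t, q, i)" "s \<in> H" "t \<in> H" "q < l" "i \<in> E q"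
      by (auto simp: F_def)
    have "i < n" "i + 2 ^ q < n" using up[OF f(4,5)] by auto
    then show "P f \<in> X \<union> Y \<and> Q f \<in> X \<union> Y \<and> fst (P f) < K f \<and> K f \<le> fst (Q f)"
      unfolding f(1) P_def Q_def K_def pt_def X prod.case using f(2,3) enc_mem_pts sandwich[of i q]
      by (auto simp: H_def enc_power_le_iff enc_power_less_iff)
  next
    fix f g u v
    assume fg: "f \<in> F" "g \<in> F" and box: "u \<in> box (P f) (Q f)" "v \<in> box (P f) (Q f)"
      "u \<in> box (P g) (Q g)" "v \<in> box (P g) (Q g)" and "snd u = snd v"
      and Kf: "fst u < K f" "K f \<le> fst v" and Kg: "fst u < K g" "K g \<le> fst v"
    obtain s t q i where f: "f = (s, t, q, i)" "s \<in> H" "t \<in> H" "q < l" "i \<in> E q"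
      using fg(1) by (auto simp: F_def)
    obtain s' t' q' i' where g: "g = (s', t', q', i')" "s' \<in> H" "t' \<in> H" "q' < l" "i' \<in> E q'"
      using fg(2) by (auto simp: F_def)
    have rev: "bitrev l (i + 2 ^ q) = bitrev l i + 2 ^ (l - 1 - q)" if "q < l" "i \<in> E q" for q i
      using bitrev_add that by (simp add: E_def)
    have coords: "enc t (s + 2 ^ i) i \<le> fst w - 1" "fst w - 1 \<le> enc t (s + 2 ^ (i + 2 ^ q)) (i + 2 ^ q)"
      "enc s (t + 2 ^ bitrev l i) (bitrev l i) \<le> snd w - 1"
      "snd w - 1 \<le> enc s (t + 2 ^ (bitrev l i + 2 ^ (l - 1 - q))) (bitrev l i + 2 ^ (l - 1 - q))"
      if "w \<in> box (P (s, t, q, i)) (Q (s, t, q, i))" "q < l" "i \<in> E q" for w s t q i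
      using that enc_power_le_iff[of t s i "i + 2 ^ q"]
        enc_power_le_iff[of s t "bitrev l i" "bitrev l i + 2 ^ (l - 1 - q)"]
      by (auto simp: box_def P_def Q_def pt_def rev)
    have block: "hi (fst w - 1) = t \<and> hi (snd w - 1) = s"
      if w: "w \<in> box (P (s, t, q, i)) (Q (s, t, q, i))" and "s \<in> H" "t \<in> H" "q < l" "i \<in> E q" for w s t q i
    proof -
      have lt: "i + 2 ^ q < n" "bitrev l i + 2 ^ (l - 1 - q) < n"
        using up that \<pi>_less[of "i + 2 ^ q"] rev by auto
      have "hi (enc t (s + 2 ^ j) j) = t" "hi (enc s (t + 2 ^ j) j) = s" if "j < n" for j
        using power_le_half[OF that] \<open>s \<in> H\<close> \<open>t \<in> H\<close> that by (auto simp: H_def intro!: enc)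
      from this[of i] this[of "i + 2 ^ q"] this[of "bitrev l i"] this[of "bitrev l i + 2 ^ (l - 1 - q)"]
      show ?thesis using lt hi_mono[OF coords(1)[OF w]] hi_mono[OF coords(2)[OF w]]
          hi_mono[OF coords(3)[OF w]] hi_mono[OF coords(4)[OF w]] that by auto
    qed
    \<comment> \<open>\<open>hi\<close> of either coordinate is constant on each box, so a common
      point identifies the cell.\<close>
    have st: "s' = s" "t' = t"
      using block[of u s t q i] block[of u s' t' q' i'] box f g by auto
    let ?\<kappa> = "(i div 2 ^ q + 1) * 2 ^ q" and ?\<kappa>' = "(i' div 2 ^ q' + 1) * 2 ^ q'"
    note cu = coords[OF box(1)[unfolded f(1)] f(4,5)] and cv = coords[OF box(2)[unfolded f(1)] f(4,5)]
      and cu' = coords[OF box(3)[unfolded g(1) st] g(4,5)] and cv' = coords[OF box(4)[unfolded g(1) st] g(4,5)]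
    have "enc t (s + 2 ^ i) i < enc t (s + 2 ^ ?\<kappa>') ?\<kappa>'"
      "enc t (s + 2 ^ i') i' < enc t (s + 2 ^ ?\<kappa>) ?\<kappa>"
      using cu(1) cu'(1) Kf(1) Kg(1) unfolding f(1) g(1) st K_def prod.case by linarith+
    then have \<kappa>1: "i < ?\<kappa>'" "i' < ?\<kappa>" unfolding enc_power_less_iff .
    have "enc t (s + 2 ^ ?\<kappa>') ?\<kappa>' \<le> enc t (s + 2 ^ (i + 2 ^ q)) (i + 2 ^ q)"
      "enc t (s + 2 ^ ?\<kappa>) ?\<kappa> \<le> enc t (s + 2 ^ (i' + 2 ^ q')) (i' + 2 ^ q')"
      using cv(2) cv'(2) Kf(2) Kg(2) unfolding f(1) g(1) st K_def prod.case by linarith+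
    then have \<kappa>2: "?\<kappa>' \<le> i + 2 ^ q" "?\<kappa> \<le> i' + 2 ^ q'" unfolding enc_power_le_iff .
    \<comment> \<open>If the scales differed, the multiple that belongs to the larger scale would
      separate a pair of the smaller scale.\<close>
    have q: "q' = q"
      using dyadic_disjoint[of i q q' "i' div 2 ^ q' + 1"] dyadic_disjoint[of i' q' q "i div 2 ^ q + 1"]
        \<kappa>1 \<kappa>2 f(5) g(5) by (cases q q' rule: linorder_cases) (auto simp: E_def)
    have same: "i div 2 ^ q = i' div 2 ^ q"
      using \<kappa>1 \<kappa>2 unfolding q by (intro dyadic_same) auto
    define \<delta> :: nat where "\<delta> = 2 ^ (l - 1 - q)"
    have \<delta>: "2 ^ (l - q) = 2 * \<delta>" unfolding \<delta>_def using f(4) by (simp flip: power_Suc)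
    \<comment> \<open>In terms of reversed indices the row ranges have length
      \<open>\<delta>\<close>, and their starts are congruent modulo \<open>2 * \<delta>\<close>; so
      they meet only if the starts agree.\<close>
    have "bitrev l i mod (2 * \<delta>) = bitrev l i' mod (2 * \<delta>)"
      using bitrev_cong[OF same, of l] f(4) \<delta> by simp
    moreover have "enc s (t + 2 ^ bitrev l i) (bitrev l i) \<le> enc s (t + 2 ^ (bitrev l i' + \<delta>)) (bitrev l i' + \<delta>)"
      "enc s (t + 2 ^ bitrev l i') (bitrev l i') \<le> enc s (t + 2 ^ (bitrev l i + \<delta>)) (bitrev l i + \<delta>)"
      using cu(3,4) cu'(3,4) unfolding q \<delta>_def by linarith+
    then have "bitrev l i \<le> bitrev l i' + \<delta>" "bitrev l i' \<le> bitrev l i + \<delta>"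
      unfolding enc_power_le_iff .
    moreover have "0 < \<delta>" by (simp add: \<delta>_def)
    ultimately have "bitrev l i = bitrev l i'"
      by (rule mod_eq_close)
    then have "i = i'" using inj_onD[OF inj_on_bitrev, of l i i'] f(5) g(5) by (auto simp: E_def)
    with f(1) g(1) st q show "f = g" by simp
  qed
  also have "\<dots> \<le> card X + opt X" using card_Un_le[of X Y] Y(2) by simp
  finally have "card F \<le> card X + opt X" .
  moreover have "8 * card F = 2 ^ n * 2 ^ n * n * l"
  proof -
    have "N = 2 * 2 ^ (n - 1)" using n by (simp add: N_def flip: power_Suc)
    then have "H = {0..<2 ^ (n - 1)}" by (auto simp: H_def)
    then have "2 * card H = 2 ^ n" using n by (simp flip: power_Suc add: nat_power_eq)
    moreover have "2 * card (SIGMA q:{..<l}. E q) = n * l"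
    proof -
      have "2 * card (SIGMA q:{..<l}. E q) = (\<Sum>q<l. card (E q) * 2)"
        by (subst card_SigmaI) (auto simp: E_def sum_distrib_left mult.commute)
      also have "\<dots> = (\<Sum>q<l. n)"
        using card_even_digit by (intro sum.cong) (auto simp: E_def n_def)
      finally show ?thesis by (simp add: mult.commute)
    qed
    moreover have "8 * card F = (2 * card H) * (2 * card H) * (2 * card (SIGMA q:{..<l}. E q))"
      by (simp add: F_def card_cartesian_product)
    ultimately show ?thesis by simp
  qed
  ultimately show ?thesis by simp
qed

section \<open>Switches and boundary crossings on a cycle\<close>

lemma finite_filter:
  assumes "finite A"
  shows "finite {x \<in> A. P x}"
  by (rule finite_subset[OF _ assms]) auto

text \<open>\<open>w div B mod N\<close> advances by one after every \<open>B\<close> values of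
  \<open>w\<close> and goes \<open>R\<close> times around the cycle, so each switch of
  \<open>C\<close> on the cycle is met at most once per round. The map \<open>f\<close> in the proof
  records round and position.\<close>

lemma card_switches_le:
  fixes B N :: int and R :: nat and C :: "int \<Rightarrow> bool"
  assumes B: "0 < B" and N: "0 < N"
  shows "card {w \<in> {0..<int R * N * B}. C (w div B mod N) \<noteq> C ((w + 1) div B mod N)}
    \<le> R * card {g \<in> {0..<N}. C g \<noteq> C ((g + 1) mod N)}" (is "card ?W \<le> R * card ?S")
proof -
  have last: "w = w div B * B + (B - 1) \<and> (w + 1) div B = w div B + 1"
    if "(w + 1) div B \<noteq> w div B" for w
  proof -
    define r where "r = w mod B"
    have r: "0 \<le> r" "r < B" "w = w div B * B + r" using B by (simp_all add: r_def)
    have "r = B - 1"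
    proof (rule ccontr)
      assume "r \<noteq> B - 1"
      with r have "(w div B * B + (r + 1)) div B = w div B" by (simp add: div_pos_pos_trivial)
      moreover have "w + 1 = w div B * B + (r + 1)" using r(3) by linarith
      ultimately have "(w + 1) div B = w div B" by (simp only:)
      with that show False by simp
    qed
    with r(3) have w: "w = w div B * B + (B - 1)" by simp
    then have "(w + 1) div B = (w div B + 1) * B div B" by (simp add: algebra_simps)
    with w B show ?thesis by simp
  qed
  define f where "f = (\<lambda>w. (w div B div N, w div B mod N))"
  have "inj_on f ?W"
  proof (rule inj_onI)
    fix w w' assume w: "w \<in> ?W" "w' \<in> ?W" "f w = f w'"
    then have "w div B = w' div B" unfolding f_def by (metis Pair_inject div_mult_mod_eq)
    moreover have "(w + 1) div B \<noteq> w div B" "(w' + 1) div B \<noteq> w' div B" using w by auto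
    ultimately show "w = w'" using last[of w] last[of w'] by simp
  qed
  moreover have "f ` ?W \<subseteq> {0..<int R} \<times> ?S"
  proof (rule image_subsetI)
    fix w assume "w \<in> ?W"
    then have w: "w \<in> {0..<int R * N * B}" "C (w div B mod N) \<noteq> C ((w + 1) div B mod N)" by auto
    have "(w + 1) div B \<noteq> w div B" using w(2) by (metis (full_types))
    then have "(w + 1) div B = w div B + 1" using last[of w] by blast
    then have "((w + 1) div B) mod N = (w div B mod N + 1) mod N" by (simp add: mod_simps)
    moreover have "w div B < int R * N" using w B by (intro int_div_less) auto
    then have "w div B div N < int R" by (rule int_div_less[OF N])
    ultimately show "f w \<in> {0..<int R} \<times> ?S" using w N B
      by (auto simp: f_def pos_imp_zdiv_nonneg_iff)
  qed
  ultimately have "card ?W \<le> card ({0..<int R} \<times> ?S)"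
    by (rule card_inj_on_le) (intro finite_cartesian_product finite_filter finite_atLeastLessThan_int)
  then show ?thesis by (simp add: card_cartesian_product)
qed

lemma inj_on_shift_mod: "inj_on (\<lambda>g. (g + e) mod N) {0..<N}" for e N :: int
proof (rule inj_onI)
  fix x y assume "x \<in> {0..<N}" "y \<in> {0..<N}" "(x + e) mod N = (y + e) mod N"
  moreover from this have "x mod N = y mod N" by (metis add_diff_cancel_right' mod_diff_cong)
  ultimately show "x = y" by simp
qed

text \<open>A cyclic translate of an interval has two ends: membership can change only right after
  \<open>q2\<close> and right before \<open>q1\<close>.\<close>

lemma card_cyclic_interval_switches:
  fixes N q1 q2 e :: int
  assumes q: "0 \<le> q1" "q2 < N"
  defines "Q \<equiv> {q1..q2}"
  shows "card {g \<in> {0..<N}. ((g - e) mod N \<in> Q) \<noteq> (((g + 1) mod N - e) mod N \<in> Q)} \<le> 2"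
    (is "card ?S \<le> 2")
proof -
  have "(\<lambda>g. (g + - e) mod N) ` ?S \<subseteq> {q2, (q1 - 1) mod N}"
  proof (rule image_subsetI, rule ccontr)
    fix g assume "g \<in> ?S" and ne: "(g + - e) mod N \<notin> {q2, (q1 - 1) mod N}"
    then have g: "g \<in> {0..<N}" "((g - e) mod N \<in> Q) \<noteq> (((g + 1) mod N - e) mod N \<in> Q)" by auto
    define h where "h = (g - e) mod N"
    have h: "0 \<le> h" "h < N" using g by (simp_all add: h_def)
    have "((g + 1) mod N - e) mod N = (h + 1) mod N"
      unfolding h_def by (simp add: mod_simps algebra_simps)
    then have sw: "(h \<in> Q) \<noteq> ((h + 1) mod N \<in> Q)" using g by (simp add: h_def)
    have "h \<noteq> (q1 - 1) mod N" using ne by (simp add: h_def)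
    have "h = q2"
    proof (cases "h + 1 < N")
      case True
      then have "(h + 1) mod N = h + 1" using h by simp
      moreover have "h \<noteq> q1 - 1" using \<open>h \<noteq> (q1 - 1) mod N\<close> h by (metis mod_pos_pos_trivial)
      ultimately show ?thesis using sw by (auto simp: Q_def)
    next
      case False
      with h have hN: "h = N - 1" by simp
      then have "(h + 1) mod N = 0" by simp
      \<comment> \<open>At the wrap, \<open>0\<close> is now outside \<open>Q\<close>, so the switch
        puts \<open>N - 1\<close> into \<open>Q\<close>, which forces
        \<open>q2 = N - 1\<close>.\<close>
      moreover have "q1 \<noteq> 0" using \<open>h \<noteq> (q1 - 1) mod N\<close> hN h by (auto simp: zmod_minus1)
      ultimately show ?thesis using sw q hN by (auto simp: Q_def)
    qed
    then show False using ne by (simp add: h_def)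
  qed
  moreover have "inj_on (\<lambda>g. (g + - e) mod N) ?S"
    using inj_on_shift_mod by (rule inj_on_subset) auto
  ultimately have "card ?S \<le> card {q2, (q1 - 1) mod N}" by (meson card_inj_on_le finite.emptyI finite_insert)
  also have "\<dots> \<le> 2" by (simp add: card_insert_if)
  finally show ?thesis .
qed

lemma card_cyclic_intervals_switches:
  fixes N q1 q2 :: int
  assumes q: "0 \<le> q1" "q2 < N" and E: "finite E"
  defines "C \<equiv> \<lambda>g. \<exists>e\<in>E. (g - e) mod N \<in> {q1..q2}"
  shows "card {g \<in> {0..<N}. C g \<noteq> C ((g + 1) mod N)} \<le> 2 * card E"
proof -
  let ?S = "\<lambda>e. {g \<in> {0..<N}. ((g - e) mod N \<in> {q1..q2}) \<noteq> (((g + 1) mod N - e) mod N \<in> {q1..q2})}"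
  have "{g \<in> {0..<N}. C g \<noteq> C ((g + 1) mod N)} \<subseteq> (\<Union>e\<in>E. ?S e)"
    unfolding C_def by blast
  then have "card {g \<in> {0..<N}. C g \<noteq> C ((g + 1) mod N)} \<le> card (\<Union>e\<in>E. ?S e)"
    by (rule card_mono[rotated]) (intro finite_UN_I E finite_filter finite_atLeastLessThan_int)
  also have "\<dots> \<le> (\<Sum>e\<in>E. card (?S e))" using E by (rule card_UN_le)
  also have "\<dots> \<le> (\<Sum>e\<in>E. 2)" using card_cyclic_interval_switches[OF q] by (intro sum_mono)
  finally show ?thesis by simp
qed

text \<open>Only the last \<open>d\<close> points, or the first \<open>- d\<close> for negative
  \<open>d\<close>, can leave the interval; reduction modulo \<open>N\<close> can only bring points
  back.\<close>

lemma card_leaving_le: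
  fixes N q1 q2 d :: int
  assumes "0 \<le> q1" "q2 < N"
  shows "int (card {z \<in> {q1..q2}. (z + d) mod N \<notin> {q1..q2}}) \<le> \<bar>d\<bar>"
proof -
  have "{z \<in> {q1..q2}. (z + d) mod N \<notin> {q1..q2}} \<subseteq> (if 0 \<le> d then {q2 - d + 1..q2} else {q1..q1 - d - 1})"
  proof clarify
    fix z assume z: "z \<in> {q1..q2}" "(z + d) mod N \<notin> {q1..q2}"
    have "z + d \<notin> {q1..q2}"
    proof
      assume "z + d \<in> {q1..q2}"
      with assms have "(z + d) mod N = z + d" by simp
      with z \<open>z + d \<in> {q1..q2}\<close> show False by simp
    qed
    with z(1) show "z \<in> (if 0 \<le> d then {q2 - d + 1..q2} else {q1..q1 - d - 1})"
      by (cases "0 \<le> d") simp_all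
  qed
  then have "card {z \<in> {q1..q2}. (z + d) mod N \<notin> {q1..q2}}
      \<le> card (if 0 \<le> d then {q2 - d + 1..q2} else {q1..q1 - d - 1})"
    by (rule card_mono[rotated]) simp
  moreover have "int (card (if 0 \<le> d then {q2 - d + 1..q2} else {q1..q1 - d - 1})) = \<bar>d\<bar>"
    by (cases "0 \<le> d") simp_all
  ultimately show ?thesis by linarith
qed

lemma card_shifted_preimage:
  fixes N e :: int
  shows "card {z \<in> {0..<N}. (z + e) mod N \<in> Q \<and> P z} \<le> card {g \<in> Q \<inter> {0..<N}. P ((g - e) mod N)}"
proof (cases "0 < N")
  case True
  show ?thesis
  proof (rule card_inj_on_le[where f = "\<lambda>z. (z + e) mod N"])
    show "inj_on (\<lambda>z. (z + e) mod N) {z \<in> {0..<N}. (z + e) mod N \<in> Q \<and> P z}"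
      using inj_on_shift_mod by (rule inj_on_subset) auto
    show "(\<lambda>z. (z + e) mod N) ` {z \<in> {0..<N}. (z + e) mod N \<in> Q \<and> P z}
        \<subseteq> {g \<in> Q \<inter> {0..<N}. P ((g - e) mod N)}"
      using True by (auto simp: mod_simps)
    show "finite {g \<in> Q \<inter> {0..<N}. P ((g - e) mod N)}"
      by (intro finite_filter finite_Int) simp
  qed
qed simp

text \<open>Points that enter \<open>Q\<close> under the translation by \<open>d\<close> correspond
  to points that leave it under the translation by \<open>- d\<close>.\<close>

lemma card_cyclic_boundary_le:
  fixes N q1 q2 d :: int
  assumes q: "0 \<le> q1" "q2 < N"
  defines "Q \<equiv> {q1..q2}"
  shows "int (card {z \<in> {0..<N}. (z \<in> Q) \<noteq> ((z + d) mod N \<in> Q)}) \<le> 2 * \<bar>d\<bar>"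
proof -
  let ?A = "{z \<in> Q. (z + d) mod N \<notin> Q}" and ?B = "{z \<in> {0..<N}. (z + d) mod N \<in> Q \<and> z \<notin> Q}"
  have "card ?B \<le> card {g \<in> Q \<inter> {0..<N}. (g - d) mod N \<notin> Q}" by (rule card_shifted_preimage)
  also have "\<dots> \<le> card {g \<in> Q. (g + - d) mod N \<notin> Q}"
    by (rule card_mono, rule finite_filter) (auto simp: Q_def)
  finally have "int (card ?B) \<le> \<bar>d\<bar>" using card_leaving_le[OF q, of "- d"] by (simp add: Q_def)
  moreover have "int (card ?A) \<le> \<bar>d\<bar>" using card_leaving_le[OF q, of d] by (simp add: Q_def)
  moreover have "{z \<in> {0..<N}. (z \<in> Q) \<noteq> ((z + d) mod N \<in> Q)} \<subseteq> ?A \<union> ?B" by auto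
  then have "card {z \<in> {0..<N}. (z \<in> Q) \<noteq> ((z + d) mod N \<in> Q)} \<le> card (?A \<union> ?B)"
    by (rule card_mono[rotated]) (intro finite_UnI finite_filter finite_atLeastLessThan_int, simp add: Q_def)
  moreover have "card (?A \<union> ?B) \<le> card ?A + card ?B" by (rule card_Un_le)
  ultimately show ?thesis by linarith
qed

lemma sum_powers_le:
  fixes m :: int
  assumes "finite I" "\<And>i. i \<in> I \<Longrightarrow> 2 ^ i \<le> m" "0 \<le> m"
  shows "(\<Sum>i\<in>I. 2 ^ i) \<le> 2 * m"
proof (cases "I = {}")
  case False
  define K where "K = Max I"
  have K: "K \<in> I" "I \<subseteq> {..K}" using assms(1) False by (auto simp: K_def)
  then have "(\<Sum>i\<in>I. 2 ^ i) \<le> (\<Sum>i\<le>K. 2 ^ i :: int)" by (intro sum_mono2) auto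
  also have "\<dots> = 2 * 2 ^ K - 1" by (induction K) auto
  finally show ?thesis using assms(2)[OF K(1)] by simp
qed (use assms in simp)

lemma not_dvd_close:
  fixes a d w N :: int
  assumes "\<bar>a\<bar> < w" "w < \<bar>d\<bar>" "\<bar>d\<bar> + w \<le> N"
  shows "\<not> N dvd a - d"
proof
  assume "N dvd a - d"
  then have "a - d = 0 \<or> \<bar>N\<bar> \<le> \<bar>a - d\<bar>" using dvd_imp_le_int by blast
  with assms show False by linarith
qed

text \<open>The scales \<open>i\<close> with \<open>2 ^ i > 2 w\<close>, where \<open>w\<close> is the width of the strip,
  are far: a group meeting the strip at a far scale has no other point in the strip.\<close>

lemma far_unique:
  fixes za zb z z' \<delta> :: int and n i i' :: nat
  defines "w \<equiv> zb - za + 1" and "N \<equiv> 2 ^ n"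
  assumes z: "z \<in> {za..zb}" "z' \<in> {za..zb}" "0 \<le> za" "zb < N" and i: "i < n" "i' < n"
    and \<delta>: "\<delta> = 1 \<or> \<delta> = -1"
    and eq: "(z + \<delta> * 2 ^ i) mod N = (z' + \<delta> * 2 ^ i') mod N" and far: "2 * w < 2 ^ i'"
  shows "i = i' \<and> z = z'"
proof -
  have N: "2 * 2 ^ j \<le> N" if "j < n" for j
    using that power_increasing[of "Suc j" n "2 :: int"] by (simp add: N_def)
  define d :: int where "d = \<delta> * (2 ^ i' - 2 ^ i)"
  have dvd: "N dvd (z - z') - d"
    using eq unfolding mod_eq_dvd_iff d_def by (simp add: algebra_simps)
  have close: "\<bar>z - z'\<bar> < w" using z by (auto simp: w_def)
  have i': "i = i'"
  proof (rule ccontr)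
    assume "i \<noteq> i'"
    \<comment> \<open>Two distinct powers, both at most \<open>N / 2\<close> and one of them above
      \<open>2 * w\<close>, differ by more than \<open>w\<close> and by at most
      \<open>N - w\<close>. As \<open>z - z'\<close> is smaller than \<open>w\<close>, the
      congruence modulo \<open>N\<close> is impossible.\<close>
    have "w < \<bar>2 ^ i' - 2 ^ i\<bar>"
    proof (cases "i < i'")
      case True
      then have "2 * 2 ^ i \<le> (2 :: int) ^ i'" using power_increasing[of "Suc i" i' "2 :: int"] by simp
      with far show ?thesis by linarith
    next
      case False
      with \<open>i \<noteq> i'\<close> have "2 * 2 ^ i' \<le> (2 :: int) ^ i" using power_increasing[of "Suc i'" i "2 :: int"] by simp
      moreover have "0 < w" using z by (simp add: w_def)
      ultimately show ?thesis using far by linarith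
    qed
    moreover have "\<bar>d\<bar> = \<bar>2 ^ i' - 2 ^ i\<bar>" using \<delta> by (auto simp: d_def abs_mult)
    moreover have "\<bar>2 ^ i' - 2 ^ i\<bar> + w \<le> N"
    proof -
      have "(0 :: int) < 2 ^ i" "(0 :: int) < 2 ^ i'" by simp_all
      with N[OF i(1)] N[OF i(2)] far show ?thesis by linarith
    qed
    ultimately show False using not_dvd_close[OF close] dvd by simp
  qed
  have "N dvd z - z'" using dvd by (simp add: d_def i')
  moreover have "\<bar>z - z'\<bar> < N" using z by auto
  ultimately have "z = z'" using dvd_imp_le_int[of "z - z'" N] by force
  with i' show ?thesis by simp
qed

text \<open>Since \<open>2 * w < 2 ^ i <= N / 2\<close>, the shift moves the strip past itself but
  not far enough around the cycle to return.\<close>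

lemma far_not_home:
  fixes za zb z \<delta> :: int and n i :: nat
  defines "w \<equiv> zb - za + 1" and "N \<equiv> 2 ^ n"
  assumes z: "z \<in> {za..zb}" "(z + \<delta> * 2 ^ i) mod N \<in> {za..zb}" and i: "i < n"
    and \<delta>: "\<delta> = 1 \<or> \<delta> = -1" and far: "2 * w < 2 ^ i"
  shows False
proof -
  define g where "g = (z + \<delta> * 2 ^ i) mod N"
  have "2 * 2 ^ i \<le> N" using i power_increasing[of "Suc i" n "2 :: int"] by (simp add: N_def)
  moreover have "N dvd (g - z) - \<delta> * 2 ^ i"
    unfolding g_def using mod_eq_dvd_iff[of "(z + \<delta> * 2 ^ i) mod N" N "z + \<delta> * 2 ^ i"]
    by (simp add: algebra_simps)
  moreover have "\<bar>g - z\<bar> < w" using z by (auto simp: w_def g_def)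
  moreover have "\<bar>\<delta> * 2 ^ i\<bar> = 2 ^ i" using \<delta> by (auto simp: abs_mult)
  ultimately show False using not_dvd_close[of "g - z" w "\<delta> * 2 ^ i" N] far by linarith
qed

section \<open>The cost of a cut through exponentially shifted blocks\<close>

lemma card_fibres_le:
  assumes "finite S" "finite A" and "\<And>a. a \<in> A \<Longrightarrow> card {p \<in> S. f p = a} \<le> R"
  shows "card {p \<in> S. f p \<in> A} \<le> R * card A"
proof -
  have "{p \<in> S. f p \<in> A} = (\<Union>a\<in>A. {p \<in> S. f p = a})" by auto
  then have "card {p \<in> S. f p \<in> A} \<le> (\<Sum>a\<in>A. card {p \<in> S. f p = a})"
    using card_UN_le[OF assms(2)] by simp
  also have "\<dots> \<le> (\<Sum>a\<in>A. R)" using assms(3) by (rule sum_mono)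
  finally show ?thesis by (simp add: mult.commute)
qed

text \<open>Here \<open>z p\<close> is the block of \<open>p\<close>, \<open>sc p\<close> its scale,
  and \<open>G\<close> the position of a row on the cycle; \<open>Q\<close> holds the blocks on one
  side, and \<open>zc\<close> is the block the cut may pass through. Off a small set
  \<open>D\<close> the colour can be read off from \<open>G (snd p)\<close> alone: this position
  lies in \<open>Q\<close> or in a far translate of \<open>Q\<close>.
  \<open>card_alternations_le\<close> then charges two for each point of \<open>D\<close> and one
  for each switch of this predicate \<open>C\<close>.\<close>

lemma card_alternations_shift_le:
  fixes S :: "point set" and n R :: nat and z :: "point \<Rightarrow> int" and sc :: "point \<Rightarrow> nat"
    and G :: "int \<Rightarrow> int" and \<delta> za zb q1 q2 zc :: int
  defines "N \<equiv> 2 ^ n" and "Q \<equiv> {q1..q2}" and "m \<equiv> q2 - q1 + 1" and "w \<equiv> zb - za + 1"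
  assumes S: "finite S" "inj_on snd S" and \<delta>: "\<delta> = 1 \<or> \<delta> = -1"
    and sc: "\<And>p. p \<in> S \<Longrightarrow> sc p < n" and z: "\<And>p. p \<in> S \<Longrightarrow> z p \<in> {za..zb}"
    and G: "\<And>p. p \<in> S \<Longrightarrow> G (snd p) = (z p + \<delta> * 2 ^ sc p) mod N"
    and za: "0 \<le> za" "zb < N" and Q: "q1 \<le> q2" "za \<le> q1" "q2 \<le> zb"
    and R: "\<And>z' i. card {p \<in> S. z p = z' \<and> sc p = i} \<le> R"
    and sw: "\<And>C :: int \<Rightarrow> bool. \<exists>W. finite W \<and> card W \<le> R * card {g \<in> {0..<N}. C g \<noteq> C ((g + 1) mod N)} \<and>
      (\<forall>p\<in>S. \<forall>q\<in>S. \<forall>w. snd p \<le> w \<and> w < snd q \<and> C (G w) \<noteq> C (G (w + 1)) \<longrightarrow> w \<in> W)"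
    and col: "\<And>p. p \<in> S \<Longrightarrow> z p \<noteq> zc \<Longrightarrow> col p = (z p \<in> Q)"
  shows "int (card (alternations S col))
    \<le> int R * (4 * int n + 2 + 8 * m + 4 * m * int (card {i. i < n \<and> m < 2 ^ i \<and> 2 ^ i \<le> 2 * w}))"
proof -
  define L where "L = {i. i < n \<and> m < 2 ^ i \<and> 2 ^ i \<le> 2 * w}"
  \<comment> \<open>Small scales: only points whose shift crosses the boundary of \<open>Q\<close>
    are exceptional, and their number is bounded by a geometric series.\<close>
  define A1 where "A1 = (SIGMA i:{i. i < n \<and> 2 ^ i \<le> m}. {z \<in> {0..<N}. (z \<in> Q) \<noteq> ((z + \<delta> * 2 ^ i) mod N \<in> Q)})"
  \<comment> \<open>Middle scales: whatever starts or ends in \<open>Q\<close> is exceptional, at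
    most \<open>2 * m\<close> blocks per scale.\<close>
  define A2 where "A2 = (SIGMA i:L. Q \<union> {z \<in> {0..<N}. (z + \<delta> * 2 ^ i) mod N \<in> Q \<and> True})"
  define A where "A = {..<n} \<times> {zc} \<union> A1 \<union> A2"
  define D where "D = {p \<in> S. (sc p, z p) \<in> A}"
  \<comment> \<open>Each far scale contributes one translate of \<open>Q\<close>; with
    \<open>Q\<close> itself these are at most \<open>n + 1\<close> cyclic intervals, with two
    switches each.\<close>
  define E where "E = insert 0 ((\<lambda>i. \<delta> * 2 ^ i) ` {i. i < n \<and> 2 * w < 2 ^ i})"
  define C where "C = (\<lambda>g. \<exists>e\<in>E. (g - e) mod N \<in> {q1..q2})"
  have q: "0 \<le> q1" "q2 < N" and m: "0 < m" using za Q by (auto simp: m_def)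
  have cardQ: "int (card Q) = m" using Q by (simp add: Q_def m_def)
  have abs\<delta>: "\<bar>\<delta> * 2 ^ i\<bar> = 2 ^ i" for i using \<delta> by (auto simp: abs_mult)
  have A1: "int (card A1) \<le> 4 * m"
  proof -
    have "card A1 = (\<Sum>i | i < n \<and> 2 ^ i \<le> m. card {z \<in> {0..<N}. (z \<in> Q) \<noteq> ((z + \<delta> * 2 ^ i) mod N \<in> Q)})"
      unfolding A1_def by (rule card_SigmaI, simp) (intro ballI finite_filter finite_atLeastLessThan_int)
    then have "int (card A1) = (\<Sum>i | i < n \<and> 2 ^ i \<le> m. int (card {z \<in> {0..<N}. (z \<in> Q) \<noteq> ((z + \<delta> * 2 ^ i) mod N \<in> Q)}))"
      by simp
    also have "\<dots> \<le> (\<Sum>i | i < n \<and> 2 ^ i \<le> m. 2 * 2 ^ i)"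
      using card_cyclic_boundary_le[OF q, of "\<delta> * 2 ^ i" for i] unfolding Q_def abs\<delta> by (intro sum_mono) auto
    also have "\<dots> = 2 * (\<Sum>i | i < n \<and> 2 ^ i \<le> m. 2 ^ i)" by (simp add: sum_distrib_left)
    also have "\<dots> \<le> 2 * (2 * m)" using m by (intro mult_left_mono sum_powers_le) auto
    finally show ?thesis by simp
  qed
  have A2: "int (card A2) \<le> 2 * m * int (card L)"
  proof -
    have "card (Q \<union> {z \<in> {0..<N}. (z + \<delta> * 2 ^ i) mod N \<in> Q \<and> True}) \<le> 2 * card Q" for i
    proof -
      have "card {z \<in> {0..<N}. (z + \<delta> * 2 ^ i) mod N \<in> Q \<and> True} \<le> card {g \<in> Q \<inter> {0..<N}. True}"
        by (rule card_shifted_preimage)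
      also have "\<dots> \<le> card Q" by (rule card_mono) (auto simp: Q_def)
      finally show ?thesis using card_Un_le[of Q "{z \<in> {0..<N}. (z + \<delta> * 2 ^ i) mod N \<in> Q \<and> True}"]
        by linarith
    qed
    moreover have "card A2 = (\<Sum>i\<in>L. card (Q \<union> {z \<in> {0..<N}. (z + \<delta> * 2 ^ i) mod N \<in> Q \<and> True}))"
      unfolding A2_def
      by (rule card_SigmaI, simp add: L_def)
        (intro ballI finite_UnI finite_filter finite_atLeastLessThan_int, simp add: Q_def)
    ultimately have "card A2 \<le> (\<Sum>i\<in>L. 2 * card Q)" by (simp only: sum_mono)
    then have "card A2 \<le> card L * (2 * card Q)" by simp
    then have "int (card A2) \<le> int (card L * (2 * card Q))" by (simp only: of_nat_le_iff)
    then show ?thesis using cardQ by (simp add: algebra_simps)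
  qed
  have finA: "finite A"
    unfolding A_def A1_def A2_def
    by (intro finite_UnI finite_SigmaI finite_filter finite_atLeastLessThan_int)
      (simp_all add: L_def Q_def)
  have "card A \<le> card ({..<n} \<times> {zc}) + card A1 + card A2"
    unfolding A_def by (metis (no_types, lifting) card_Un_le add_le_mono1 le_trans)
  then have cardA: "int (card A) \<le> int n + 4 * m + 2 * m * int (card L)"
    using A1 A2 by (simp add: card_cartesian_product)
  have "card D \<le> R * card A"
    unfolding D_def
  proof (rule card_fibres_le[OF S(1) finA])
    fix a assume "a \<in> A"
    show "card {p \<in> S. (sc p, z p) = a} \<le> R"
      using R[of "snd a" "fst a"] by (cases a) (simp add: conj_commute)
  qed
  then have "int (card D) \<le> int R * int (card A)" by (metis of_nat_le_iff of_nat_mult)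
  also have "\<dots> \<le> int R * (int n + 4 * m + 2 * m * int (card L))"
    using cardA by (intro mult_left_mono) auto
  finally have cardD: "int (card D) \<le> int R * (int n + 4 * m + 2 * m * int (card L))" .
  have "card E \<le> n + 1"
  proof -
    have "card E \<le> Suc (card ((\<lambda>i. \<delta> * 2 ^ i :: int) ` {i. i < n \<and> 2 * w < 2 ^ i}))"
      unfolding E_def by (rule card_insert_le_m1) auto
    also have "card ((\<lambda>i. \<delta> * 2 ^ i :: int) ` {i. i < n \<and> 2 * w < 2 ^ i}) \<le> card {i. i < n \<and> 2 * w < 2 ^ i}"
      by (rule card_image_le) simp
    also have "\<dots> \<le> card {..<n}" by (rule card_mono) auto
    finally show ?thesis by simp
  qed
  then have "2 * card E \<le> 2 * (n + 1)" by simp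
  moreover have "finite E" by (simp add: E_def)
  ultimately have switches: "card {g \<in> {0..<N}. C g \<noteq> C ((g + 1) mod N)} \<le> 2 * (n + 1)"
    using card_cyclic_intervals_switches[OF q, of E] unfolding C_def by (meson le_trans)
  obtain W where W: "finite W" "card W \<le> R * card {g \<in> {0..<N}. C g \<noteq> C ((g + 1) mod N)}"
    "\<And>p q w. p \<in> S \<Longrightarrow> q \<in> S \<Longrightarrow> snd p \<le> w \<Longrightarrow> w < snd q \<Longrightarrow> C (G w) \<noteq> C (G (w + 1)) \<Longrightarrow> w \<in> W"
    using sw[of C] by blast
  have N: "0 < N" by (simp add: N_def)
  have colC: "col p = C (G (snd p))" if p: "p \<in> S - D" for p
  proof -
    let ?z = "z p" and ?i = "sc p" and ?g = "G (snd p)"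
    have i: "?i < n" and zp: "?z \<in> {za..zb}" and g: "?g = (?z + \<delta> * 2 ^ ?i) mod N"
      using p sc z G by auto
    have z0: "?z \<in> {0..<N}" using zp za by auto
    have gmod: "?g mod N = ?g" by (simp add: g)
    have "?z \<noteq> zc" using p i by (auto simp: D_def A_def)
    then have colz: "col p = (?z \<in> Q)" using p col by auto
    \<comment> \<open>A point whose row position lies in a far translate of \<open>Q\<close> has
      that very scale and starts in \<open>Q\<close>, so the translates never predict a wrong
      colour.\<close>
    have far: "?i = i' \<and> ?z = (?g - \<delta> * 2 ^ i') mod N"
      if "i' < n" "2 * w < 2 ^ i'" "(?g - \<delta> * 2 ^ i') mod N \<in> Q" for i'
    proof (rule far_unique[of ?z za zb "(?g - \<delta> * 2 ^ i') mod N" n ?i i' \<delta>])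
      show "(?z + \<delta> * 2 ^ ?i) mod 2 ^ n = ((?g - \<delta> * 2 ^ i') mod N + \<delta> * 2 ^ i') mod 2 ^ n"
        using g gmod unfolding N_def[symmetric] by (simp add: mod_simps)
    qed (use that zp za i \<delta> Q in \<open>auto simp: w_def N_def Q_def\<close>)
    have Cg: "C ?g \<longleftrightarrow> ?g \<in> Q \<or> (\<exists>i'. i' < n \<and> 2 * w < 2 ^ i' \<and> (?g - \<delta> * 2 ^ i') mod N \<in> Q)"
      unfolding C_def E_def Q_def[symmetric] by (simp add: gmod)
    show ?thesis
    proof (cases "2 * w < 2 ^ ?i")
      case True
      have "?g \<notin> Q"
      proof
        assume "?g \<in> Q"
        then have "?g \<in> {za..zb}" using Q by (auto simp: Q_def)
        then show False using far_not_home[of ?z za zb \<delta> ?i n] zp g i \<delta> True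
          by (simp add: N_def w_def)
      qed
      moreover have "(?g - \<delta> * 2 ^ ?i) mod N = ?z" using z0 unfolding g by (simp add: mod_simps)
      ultimately show ?thesis
        using far i True unfolding colz Cg by metis
    next
      case False
      have "(?z \<in> Q) = (?g \<in> Q)"
      proof (cases "2 ^ ?i \<le> m")
        case True
        then have "(?i, ?z) \<notin> A1" using p by (auto simp: D_def A_def)
        with True i z0 g show ?thesis by (auto simp: A1_def)
      next
        case mid: False
        then have "(?i, ?z) \<notin> A2" using p by (auto simp: D_def A_def)
        with mid False i z0 g show ?thesis by (auto simp: A2_def L_def)
      qed
      then show ?thesis
        using far False unfolding colz Cg by metis
    qed
  qed
  have "card (alternations S col) \<le> 2 * card D + card W"
  proof (rule card_alternations_le[OF S _ W(1), where b = "\<lambda>y. C (G y)"])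
    show "D \<subseteq> S" by (auto simp: D_def)
    show "col p = C (G (snd p))" if "p \<in> S - D" for p using that by (rule colC)
    show "v \<in> W" if "p \<in> S" "q \<in> S" "snd p \<le> v" "v < snd q" "C (G v) \<noteq> C (G (v + 1))" for p q v
      using that by (rule W(3))
  qed
  moreover have "card W \<le> R * (2 * (n + 1))"
    using W(2) switches by (meson le_trans mult_le_mono2)
  then have "int (card W) \<le> int (R * (2 * (n + 1)))" by (simp only: of_nat_le_iff)
  then have "int (card W) \<le> int R * (2 * (int n + 1))" by (simp add: algebra_simps)
  ultimately have "int (card (alternations S col)) \<le> 2 * (int R * (int n + 4 * m + 2 * m * int (card L))) + int R * (2 * (int n + 1))"
    using cardD by linarith
  then show ?thesis unfolding L_def by (simp add: algebra_simps)
qed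

lemma alternations_Not: "alternations S (\<lambda>p. \<not> col p) = alternations S col"
  unfolding alternations_def by auto

section \<open>The potential u log u\<close>

lemma xlogx_superadd:
  fixes u v v' :: int
  assumes "0 \<le> v" "0 \<le> v'" "v + v' \<le> u"
  shows "v * log 2 v + v' * log 2 v' \<le> u * log 2 u"
proof (cases "u = 0")
  case False
  then have u: "1 \<le> u" using assms by simp
  have le: "x * log 2 x \<le> x * log 2 u" if "0 \<le> x" "x \<le> u" for x :: int
    using that by (cases "x = 0") (auto intro!: mult_left_mono)
  have "v * log 2 v + v' * log 2 v' \<le> v * log 2 u + v' * log 2 u"
    using le[of v] le[of v'] assms by simp
  also have "\<dots> = real_of_int (v + v') * log 2 u" by (simp add: distrib_right)
  also have "\<dots> \<le> u * log 2 u"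
    using assms u by (intro mult_right_mono) (auto simp del: of_int_add)
  finally show ?thesis .
next
  case True
  then have "v = 0" "v' = 0" using assms by simp_all
  with True show ?thesis by simp
qed

text \<open>\<open>v * log 2 v + v * log 2 (u / v) = v * log 2 u\<close>: the cost is exactly what
  the smaller part loses in its logarithm. For the other part monotonicity suffices.\<close>

lemma xlogx_split:
  fixes u v v' :: int
  assumes "1 \<le> v" "v \<le> v'" "v + v' \<le> u"
  shows "v * log 2 v + v' * log 2 v' + v * log 2 (u / v) \<le> u * log 2 u"
proof -
  have "v * log 2 v + v * log 2 (u / v) = v * log 2 u"
    using assms by (simp add: log_divide algebra_simps)
  moreover have "v' * log 2 v' \<le> v' * log 2 u" using assms by (intro mult_left_mono) auto
  moreover have "v * log 2 u + v' * log 2 u = real_of_int (v + v') * log 2 u" by (simp add: distrib_right)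
  moreover have "real_of_int (v + v') * log 2 u \<le> u * log 2 u"
    using assms by (intro mult_right_mono) (auto simp del: of_int_add)
  ultimately show ?thesis by linarith
qed

lemma card_power_range_le:
  fixes m w :: int
  assumes m: "0 < m" "m \<le> w"
  shows "real (card {i. i < n \<and> m < 2 ^ i \<and> 2 ^ i \<le> 2 * w}) \<le> log 2 (w / m) + 2"
proof -
  define L where "L = {i. i < n \<and> m < 2 ^ i \<and> 2 ^ i \<le> 2 * w}"
  have fin: "finite L" by (simp add: L_def)
  have log0: "0 \<le> log 2 (w / m)" using m by simp
  show ?thesis
  proof (cases "L = {}")
    case True
    with log0 show ?thesis unfolding L_def[symmetric] by simp
  next
    case False
    define i where "i = Min L"
    define j where "j = Max L"
    have ij: "i \<in> L" "j \<in> L" "L \<subseteq> {i..j}" using fin False by (auto simp: i_def j_def)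
    then have le: "i \<le> j" by auto
    have cardL: "card L \<le> j - i + 1" using card_mono[OF _ ij(3)] le by simp
    have "2 ^ (j - i) * m \<le> 2 * w"
    proof -
      have "2 ^ (j - i) * m \<le> 2 ^ (j - i) * 2 ^ i" using ij(1) by (simp add: L_def)
      also have "\<dots> = 2 ^ j" using le by (simp flip: power_add)
      finally show ?thesis using ij(2) by (simp add: L_def)
    qed
    then have "real_of_int (2 ^ (j - i) * m) \<le> real_of_int (2 * w)" by (simp only: of_int_le_iff)
    then have "2 ^ (j - i) \<le> 2 * (w / m)" using m by (simp add: field_simps)
    then have "log 2 (2 ^ (j - i)) \<le> log 2 (2 * (w / m))" using m by (subst log_le_cancel_iff) auto
    moreover have "log 2 (2 * (w / m)) = 1 + log 2 (w / m)" using m by (subst log_mult) auto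
    ultimately have "real (j - i) \<le> 1 + log 2 (w / m)" by (simp only: log_pow_cancel)
    with cardL show ?thesis unfolding L_def[symmetric] by simp
  qed
qed

text \<open>\<open>v\<close> boundaries separate \<open>v + 1\<close> blocks, hence the shifts by
  one. By \<open>2 * v <= u\<close> the logarithm is at least \<open>1\<close> and absorbs the
  linear terms; the number of middle scales is at most three times the logarithm.\<close>

lemma shift_bound:
  fixes u v :: int
  assumes v: "1 \<le> v" "2 * v \<le> u"
  shows "real_of_int (4 * int n + 2 + 8 * (v + 1) + 4 * (v + 1) *
      int (card {i. i < n \<and> v + 1 < 2 ^ i \<and> 2 ^ i \<le> 2 * (u + 1)}))
    \<le> 40 * (v * log 2 (u / v)) + 4 * (real n + 1)"
proof -
  define L where "L = real (card {i. i < n \<and> v + 1 < 2 ^ i \<and> 2 ^ i \<le> 2 * (u + 1)})"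
  define \<rho> where "\<rho> = log 2 (u / v)"
  have "2 \<le> real_of_int u / v" using v by (simp add: field_simps flip: of_int_mult)
  then have "log 2 2 \<le> \<rho>" unfolding \<rho>_def by (subst log_le_cancel_iff) auto
  then have \<rho>: "1 \<le> \<rho>" by simp
  have "L \<le> log 2 (real_of_int (u + 1) / real_of_int (v + 1)) + 2"
    unfolding L_def using v by (intro card_power_range_le) auto
  also have "log 2 (real_of_int (u + 1) / real_of_int (v + 1)) \<le> \<rho>"
    unfolding \<rho>_def using v by (subst log_le_cancel_iff) (auto simp: field_simps)
  finally have L: "L \<le> 3 * \<rho>" using \<rho> by simp
  have v2: "real_of_int v + 1 \<le> 2 * v" using v by simp
  have "(real_of_int v + 1) * L \<le> (2 * v) * (3 * \<rho>)"
    using v2 L v by (intro mult_mono) (auto simp: L_def)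
  then have L: "(real_of_int v + 1) * L \<le> 6 * (v * \<rho>)" by simp
  have v\<rho>: "real_of_int v * 1 \<le> v * \<rho>" using \<rho> v by (intro mult_left_mono) auto
  have "real_of_int (4 * int n + 2 + 8 * (v + 1) + 4 * (v + 1) *
      int (card {i. i < n \<and> v + 1 < 2 ^ i \<and> 2 ^ i \<le> 2 * (u + 1)}))
    = 4 * real n + 2 + 8 * real_of_int v + 8 + 4 * ((real_of_int v + 1) * L)"
    by (simp add: L_def)
  also have "\<dots> \<le> 40 * (v * \<rho>) + 4 * (real n + 1)"
  proof -
    have "1 \<le> real_of_int v" using v by simp
    with L v\<rho> show ?thesis by argo
  qed
  finally show ?thesis unfolding \<rho>_def .
qed

text \<open>Potential of a strip containing \<open>u\<close> boundaries between blocks. The summand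
  \<open>2 * (b - a + 1)\<close> pays once for every point whose strip ceases to contain a boundary.\<close>

definition xlogx_potential :: "nat \<Rightarrow> nat \<Rightarrow> int \<Rightarrow> real" where
  "xlogx_potential n R u = R * (40 * (u * log 2 u) + 4 * (real n + 1) * max 0 (real_of_int u - 1))"

definition level_potential :: "nat \<Rightarrow> nat \<Rightarrow> (int \<Rightarrow> int) \<Rightarrow> int \<Rightarrow> int \<Rightarrow> real" where
  "level_potential n R \<beta> a b = (if \<beta> (a - 1) < \<beta> (b - 1) then 2 * (real_of_int b - a + 1) else 0)
     + xlogx_potential n R (\<beta> (b - 1) - \<beta> (a - 1))"

lemma xlogx_potential_nonneg: "0 \<le> u \<Longrightarrow> 0 \<le> xlogx_potential n R u"
  unfolding xlogx_potential_def using xlogx_superadd[of 0 0 u] by (simp add: add_nonneg_nonneg)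

lemma xlogx_potential_superadd:
  assumes "0 \<le> v" "0 \<le> v'" "v + v' \<le> u"
  shows "xlogx_potential n R v + xlogx_potential n R v' \<le> xlogx_potential n R u"
proof -
  have "40 * (v * log 2 v) + 40 * (v' * log 2 v') \<le> 40 * (u * log 2 u)"
    using xlogx_superadd[OF assms] by simp
  moreover have "4 * (real n + 1) * max 0 (real_of_int v - 1) + 4 * (real n + 1) * max 0 (real_of_int v' - 1)
      \<le> 4 * (real n + 1) * max 0 (real_of_int u - 1)"
    unfolding distrib_left[symmetric] using assms by (intro mult_left_mono) auto
  ultimately have "R * ((40 * (v * log 2 v) + 4 * (real n + 1) * max 0 (real_of_int v - 1)) +
      (40 * (v' * log 2 v') + 4 * (real n + 1) * max 0 (real_of_int v' - 1)))
      \<le> R * (40 * (u * log 2 u) + 4 * (real n + 1) * max 0 (real_of_int u - 1))"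
    by (intro mult_left_mono) auto
  then show ?thesis unfolding xlogx_potential_def by (simp only: distrib_left)
qed

text \<open>The fixed cost \<open>4 * (real n + 1)\<close> comes from the term with
  \<open>u - 1\<close>: if both parts keep a boundary, then
  \<open>(v - 1) + (v' - 1) + 1 <= u - 1\<close>.\<close>

lemma xlogx_potential_split:
  assumes "1 \<le> v" "v \<le> v'" "v + v' \<le> u"
  shows "R * (40 * (v * log 2 (u / v)) + 4 * (real n + 1)) + xlogx_potential n R v + xlogx_potential n R v'
    \<le> xlogx_potential n R u"
proof -
  have "40 * (v * log 2 (u / v)) + 40 * (v * log 2 v) + 40 * (v' * log 2 v') \<le> 40 * (u * log 2 u)"
    using xlogx_split[OF assms] by simp
  moreover have "4 * (real n + 1) * (1 + (max 0 (real_of_int v - 1) + max 0 (real_of_int v' - 1)))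
      \<le> 4 * (real n + 1) * max 0 (real_of_int u - 1)"
    using assms by (intro mult_left_mono) auto
  ultimately have "R * ((40 * (v * log 2 (u / v)) + 4 * (real n + 1)) +
      (40 * (v * log 2 v) + 4 * (real n + 1) * max 0 (real_of_int v - 1)) +
      (40 * (v' * log 2 v') + 4 * (real n + 1) * max 0 (real_of_int v' - 1)))
      \<le> R * (40 * (u * log 2 u) + 4 * (real n + 1) * max 0 (real_of_int u - 1))"
    unfolding distrib_left[of "4 * (real n + 1)"] mult_1_right by (intro mult_left_mono) linarith+
  then show ?thesis unfolding xlogx_potential_def by (simp only: distrib_left)
qed

lemma level_potential_nonneg:
  assumes "mono \<beta>" "a \<le> b"
  shows "0 \<le> level_potential n R \<beta> a b"
proof -
  have "\<beta> (a - 1) \<le> \<beta> (b - 1)" using assms by (simp add: monoD)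
  then show ?thesis
    using assms(2) unfolding level_potential_def by (intro add_nonneg_nonneg xlogx_potential_nonneg) auto
qed

lemma level_potential_superadd:
  assumes "mono \<beta>" "a \<le> k" "k < b"
  shows "level_potential n R \<beta> a k + level_potential n R \<beta> (k + 1) b \<le> level_potential n R \<beta> a b"
proof -
  have m: "\<beta> (a - 1) \<le> \<beta> (k - 1)" "\<beta> (k - 1) \<le> \<beta> k" "\<beta> k \<le> \<beta> (b - 1)"
    using assms by (simp_all add: monoD)
  then have "xlogx_potential n R (\<beta> (k - 1) - \<beta> (a - 1)) + xlogx_potential n R (\<beta> (b - 1) - \<beta> k)
      \<le> xlogx_potential n R (\<beta> (b - 1) - \<beta> (a - 1))"
    by (intro xlogx_potential_superadd) auto
  then show ?thesis unfolding level_potential_def using assms(2,3) m by auto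
qed

text \<open>If both parts keep a boundary, the cut is paid by the logarithmic term. Otherwise some
  part has none and gives up its summand of \<open>2\<close> per column, which covers
  \<open>c\<close>.\<close>

lemma level_potential_step:
  fixes c :: real
  assumes \<beta>: "mono \<beta>" and k: "a \<le> k" "k < b" and ab: "\<beta> (a - 1) < \<beta> (b - 1)"
    and c: "c \<le> 2 * (real_of_int k - a + 1)" "c \<le> 2 * (real_of_int b - k)"
    and step: "\<And>v :: int. v = min (\<beta> (k - 1) - \<beta> (a - 1)) (\<beta> (b - 1) - \<beta> k) \<Longrightarrow> 1 \<le> v \<Longrightarrow>
      c \<le> R * (40 * (v * log 2 (real_of_int (\<beta> (b - 1) - \<beta> (a - 1)) / v)) + 4 * (real n + 1))"
  shows "c + level_potential n R \<beta> a k + level_potential n R \<beta> (k + 1) b \<le> level_potential n R \<beta> a b"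
proof -
  \<comment> \<open>Columns of the strip count from \<open>1\<close>, arguments of
    \<open>\<beta>\<close> from \<open>0\<close>: the left part ends at \<open>k - 1\<close> and the
    right part begins at \<open>k\<close>.\<close>
  let ?v = "\<beta> (k - 1) - \<beta> (a - 1)" and ?v' = "\<beta> (b - 1) - \<beta> k" and ?u = "\<beta> (b - 1) - \<beta> (a - 1)"
  have m: "\<beta> (a - 1) \<le> \<beta> (k - 1)" "\<beta> (k - 1) \<le> \<beta> k" "\<beta> k \<le> \<beta> (b - 1)"
    using \<beta> k by (simp_all add: monoD)
  show ?thesis
  proof (cases "1 \<le> ?v \<and> 1 \<le> ?v'")
    case True
    have "c + xlogx_potential n R ?v + xlogx_potential n R ?v' \<le> xlogx_potential n R ?u"
    proof (cases "?v \<le> ?v'")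
      case le: True
      then show ?thesis using True m step[of ?v] xlogx_potential_split[of ?v ?v' ?u R n] by simp
    next
      case False
      then show ?thesis using True m step[of ?v'] xlogx_potential_split[of ?v' ?v ?u R n] by simp
    qed
    then show ?thesis using True ab k unfolding level_potential_def by simp
  next
    case False
    have "xlogx_potential n R ?v + xlogx_potential n R ?v' \<le> xlogx_potential n R ?u"
      using m by (intro xlogx_potential_superadd) auto
    then show ?thesis using False m ab k c unfolding level_potential_def by (auto split: if_splits)
  qed
qed

section \<open>Vertical cuts of the array on three levels\<close>

context shift_grid
begin

lemma finite_strip: "finite (strip pts a b)"
  using finite_pts by (simp add: strip_def)

lemma inj_on_snd_strip: "inj_on snd (strip pts a b)"
  using inj_on_snd_pts by (rule inj_on_subset) (auto simp: strip_def)

lemma rel_strip: "p \<in> strip pts a b \<Longrightarrow> rel (fst p - 1) (snd p - 1)"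
  by (auto simp: strip_def pts_def)

lemma strip_bounds:
  assumes "p \<in> strip pts a b"
  shows "a - 1 \<le> fst p - 1" "fst p - 1 \<le> b - 1" "0 \<le> fst p - 1" "fst p - 1 < T" "0 \<le> snd p - 1" "snd p - 1 < T"
  using assms rel_strip[OF assms] by (auto simp: strip_def rel_def)

text \<open>The points left of the cut are taken as exceptional; each is in at most two
  alternations, and no two share a column.\<close>

lemma strip_cost_le_left:
  assumes "a \<le> k" "k < b"
  shows "real (strip_cost pts a b k) \<le> 2 * (real_of_int k - a + 1)"
proof -
  have "card {p \<in> strip pts a b. fst p \<le> k} \<le> card {a..k}"
  proof (rule card_inj_on_le[where f = fst])
    show "inj_on fst {p \<in> strip pts a b. fst p \<le> k}"
      using inj_on_fst_pts by (rule inj_on_subset) (auto simp: strip_def)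
  qed (auto simp: strip_def)
  moreover have "strip_cost pts a b k \<le> 2 * card {p \<in> strip pts a b. fst p \<le> k}"
    unfolding strip_cost_def
    by (rule card_alternations_le_twice[OF finite_strip inj_on_snd_strip, where c = False]) auto
  ultimately have "strip_cost pts a b k \<le> 2 * card {a..k}" by linarith
  then have "real (strip_cost pts a b k) \<le> real (2 * card {a..k})" by (simp only: of_nat_le_iff)
  then show ?thesis using assms by simp
qed

lemma strip_cost_le_right:
  assumes "a \<le> k" "k < b"
  shows "real (strip_cost pts a b k) \<le> 2 * (real_of_int b - k)"
proof -
  have "card {p \<in> strip pts a b. \<not> fst p \<le> k} \<le> card {k + 1..b}"
  proof (rule card_inj_on_le[where f = fst])
    show "inj_on fst {p \<in> strip pts a b. \<not> fst p \<le> k}"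
      using inj_on_fst_pts by (rule inj_on_subset) (auto simp: strip_def)
  qed (auto simp: strip_def)
  moreover have "strip_cost pts a b k \<le> 2 * card {p \<in> strip pts a b. \<not> fst p \<le> k}"
    unfolding strip_cost_def
    by (rule card_alternations_le_twice[OF finite_strip inj_on_snd_strip, where c = True]) auto
  ultimately have "strip_cost pts a b k \<le> 2 * card {k + 1..b}" by linarith
  then have "real (strip_cost pts a b k) \<le> real (2 * card {k + 1..b})" by (simp only: of_nat_le_iff)
  then show ?thesis using assms by simp
qed

text \<open>The rows go \<open>R\<close> times around the cycle and stay \<open>B\<close> rows at
  each position. The set is shifted by one because rows count from \<open>1\<close>.\<close>

lemma switching_set:
  fixes C :: "int \<Rightarrow> bool"
  assumes B: "0 < B" and RB: "int R * N * B = T"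
    and G: "\<And>y. 0 \<le> y \<Longrightarrow> y < T \<Longrightarrow> G (y + 1) = y div B mod N"
  shows "\<exists>W. finite W \<and> card W \<le> R * card {g \<in> {0..<N}. C g \<noteq> C ((g + 1) mod N)} \<and>
      (\<forall>p\<in>strip pts a b. \<forall>q\<in>strip pts a b. \<forall>w. snd p \<le> w \<and> w < snd q \<and> C (G w) \<noteq> C (G (w + 1)) \<longrightarrow> w \<in> W)"
proof (intro exI conjI ballI allI impI)
  let ?V = "{w \<in> {0..<int R * N * B}. C (w div B mod N) \<noteq> C ((w + 1) div B mod N)}"
  have "finite ?V" by (intro finite_filter finite_atLeastLessThan_int)
  then show "finite ((\<lambda>w. w + 1) ` ?V)" by (rule finite_imageI)
  have "card ((\<lambda>w. w + 1) ` ?V) = card ?V" by (intro card_image) (simp add: inj_on_def)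
  then show "card ((\<lambda>w. w + 1) ` ?V) \<le> R * card {g \<in> {0..<N}. C g \<noteq> C ((g + 1) mod N)}"
    using card_switches_le[OF B N_pos, where R = R and C = C] by simp
  fix p q w assume pq: "p \<in> strip pts a b" "q \<in> strip pts a b" and w: "snd p \<le> w \<and> w < snd q \<and> C (G w) \<noteq> C (G (w + 1))"
  have "0 \<le> w - 1" "w < T" using strip_bounds[OF pq(1)] strip_bounds[OF pq(2)] w by auto
  then have "w - 1 \<in> ?V" using G[of "w - 1"] G[of w] w unfolding RB by simp
  then show "w \<in> (\<lambda>w. w + 1) ` ?V" by (rule rev_image_eqI) simp
qed

text \<open>Common core of the two upper levels: \<open>\<beta>\<close> gives the block of a column,
  and \<open>off\<close> moves the blocks of the strip into one period of the cycle.
  \<open>Q\<close> is the side with fewer boundaries.\<close>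

lemma strip_cost_level:
  fixes \<beta> :: "int \<Rightarrow> int"
  assumes k: "a \<le> k" "k < b" and \<beta>: "mono \<beta>"
    and off: "off \<le> \<beta> (a - 1)" "\<beta> (b - 1) < off + N" and \<delta>: "\<delta> = 1 \<or> \<delta> = -1"
    and sc: "\<And>p. p \<in> strip pts a b \<Longrightarrow> sc p < n"
    and G: "\<And>p. p \<in> strip pts a b \<Longrightarrow> G (snd p) = (\<beta> (fst p - 1) - off + \<delta> * 2 ^ sc p) mod N"
    and R: "\<And>z i. card {p \<in> strip pts a b. \<beta> (fst p - 1) - off = z \<and> sc p = i} \<le> R"
    and sw: "\<And>C :: int \<Rightarrow> bool. \<exists>W. finite W \<and> card W \<le> R * card {g \<in> {0..<N}. C g \<noteq> C ((g + 1) mod N)} \<and>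
      (\<forall>p\<in>strip pts a b. \<forall>q\<in>strip pts a b. \<forall>w. snd p \<le> w \<and> w < snd q \<and> C (G w) \<noteq> C (G (w + 1)) \<longrightarrow> w \<in> W)"
    and v: "v = min (\<beta> (k - 1) - \<beta> (a - 1)) (\<beta> (b - 1) - \<beta> k)" "1 \<le> v"
  shows "real (strip_cost pts a b k)
    \<le> R * (40 * (v * log 2 (real_of_int (\<beta> (b - 1) - \<beta> (a - 1)) / v)) + 4 * (real n + 1))"
proof -
  define z where "z = (\<lambda>p :: point. \<beta> (fst p - 1) - off)"
  let ?S = "strip pts a b" and ?za = "\<beta> (a - 1) - off" and ?zb = "\<beta> (b - 1) - off" and ?zc = "\<beta> (k - 1) - off"
  have m: "\<beta> (a - 1) \<le> \<beta> (k - 1)" "\<beta> (k - 1) \<le> \<beta> k" "\<beta> k \<le> \<beta> (b - 1)"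
    using \<beta> k by (simp_all add: monoD)
  have zmem: "z p \<in> {?za..?zb}" if "p \<in> ?S" for p
    using strip_bounds[OF that] \<beta> by (simp add: z_def monoD)
  have left: "\<beta> (fst p - 1) \<le> \<beta> (k - 1)" if "fst p \<le> k" for p :: point
    using that by (intro monoD[OF \<beta>]) simp
  have right: "\<beta> k \<le> \<beta> (fst p - 1)" if "\<not> fst p \<le> k" for p :: point
    using that by (intro monoD[OF \<beta>]) simp
  have main: "int (card (alternations ?S col)) \<le> int R * (4 * int n + 2 + 8 * (v + 1) + 4 * (v + 1) *
      int (card {i. i < n \<and> v + 1 < 2 ^ i \<and> 2 ^ i \<le> 2 * (\<beta> (b - 1) - \<beta> (a - 1) + 1)}))"
    if q: "q1 \<le> q2" "?za \<le> q1" "q2 \<le> ?zb" "q2 - q1 = v"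
      and col: "\<And>p. p \<in> ?S \<Longrightarrow> z p \<noteq> ?zc \<Longrightarrow> col p = (z p \<in> {q1..q2})" for q1 q2 col
  proof -
    have eqs: "q2 - q1 + 1 = v + 1" "?zb - ?za + 1 = \<beta> (b - 1) - \<beta> (a - 1) + 1" using q by simp_all
    have "int (card (alternations ?S col)) \<le> int R * (4 * int n + 2 + 8 * (q2 - q1 + 1) + 4 * (q2 - q1 + 1) *
      int (card {i. i < n \<and> q2 - q1 + 1 < 2 ^ i \<and> 2 ^ i \<le> 2 * (?zb - ?za + 1)}))"
    proof (rule card_alternations_shift_le[where z = z and G = G and sc = sc and \<delta> = \<delta> and zc = ?zc])
      show "G (snd p) = (z p + \<delta> * 2 ^ sc p) mod 2 ^ n" if "p \<in> ?S" for p
        using G[OF that] by (simp add: z_def N_def)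
      show "card {p \<in> ?S. z p = z' \<and> sc p = i} \<le> R" for z' i
        using R unfolding z_def .
      show "\<exists>W. finite W \<and> card W \<le> R * card {g \<in> {0..<2 ^ n}. C g \<noteq> C ((g + 1) mod 2 ^ n)} \<and>
        (\<forall>p\<in>?S. \<forall>q\<in>?S. \<forall>w. snd p \<le> w \<and> w < snd q \<and> C (G w) \<noteq> C (G (w + 1)) \<longrightarrow> w \<in> W)"
        for C :: "int \<Rightarrow> bool"
        using sw[of C] unfolding N_def .
      show "?zb < 2 ^ n" using off by (simp add: N_def)
    qed (use finite_strip inj_on_snd_strip \<delta> sc zmem off q col in auto)
    then show ?thesis unfolding eqs .
  qed
  define M where "M = 4 * int n + 2 + 8 * (v + 1) + 4 * (v + 1) *
      int (card {i. i < n \<and> v + 1 < 2 ^ i \<and> 2 ^ i \<le> 2 * (\<beta> (b - 1) - \<beta> (a - 1) + 1)})"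
  have "int (strip_cost pts a b k) \<le> int R * M"
  proof (cases "v = \<beta> (k - 1) - \<beta> (a - 1)")
    case True
    show ?thesis unfolding strip_cost_def M_def
    proof (rule main[of ?za ?zc])
      fix p assume "p \<in> ?S" "z p \<noteq> ?zc"
      then show "(fst p \<le> k) = (z p \<in> {?za..?zc})"
        using left[of p] right[of p] zmem[of p] m by (cases "fst p \<le> k") (auto simp: z_def)
    qed (use True m v in auto)
  next
    case False
    then have v': "v = \<beta> (b - 1) - \<beta> k" using v(1) by linarith
    \<comment> \<open>If the right side is the smaller one, the colours are exchanged, which does
      not affect alternations.\<close>
    show ?thesis unfolding strip_cost_def M_def alternations_Not[of _ "\<lambda>p. fst p \<le> k", symmetric]
    proof (rule main[of "\<beta> k - off" ?zb])
      fix p assume "p \<in> ?S" "z p \<noteq> ?zc"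
      then show "(\<not> fst p \<le> k) = (z p \<in> {\<beta> k - off..?zb})"
        using left[of p] right[of p] zmem[of p] m by (cases "fst p \<le> k") (auto simp: z_def)
    qed (use v' m v in auto)
  qed
  then have "real_of_int (int (strip_cost pts a b k)) \<le> real_of_int (int R * M)"
    by (simp only: of_int_le_iff)
  then have "real (strip_cost pts a b k) \<le> R * real_of_int M"
    by (simp only: of_int_mult of_int_of_nat_eq)
  also have "\<dots> \<le> R * (40 * (v * log 2 (real_of_int (\<beta> (b - 1) - \<beta> (a - 1)) / v)) + 4 * (real n + 1))"
  proof (rule mult_left_mono)
    have "2 * v \<le> \<beta> (b - 1) - \<beta> (a - 1)" using v m by linarith
    with v(2) show "real_of_int M \<le> 40 * (v * log 2 (real_of_int (\<beta> (b - 1) - \<beta> (a - 1)) / v)) + 4 * (real n + 1)"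
      unfolding M_def by (rule shift_bound)
  qed simp
  finally show ?thesis .
qed

definition col_index :: "int \<Rightarrow> int" where "col_index x = x div int n"

lemma mono_col_index: "mono col_index"
  unfolding col_index_def using n by (intro monoI zdiv_mono1) auto

lemma mono_hi: "mono hi"
  by (intro monoI hi_mono)

lemma mid_eq: "0 \<le> x \<Longrightarrow> x < T \<Longrightarrow> mid x = col_index x - hi x * N"
  unfolding mid_def col_index_def hi_eq by (simp add: minus_div_mult_eq_mod)

lemma hi_rel: "rel x y \<Longrightarrow> hi y = (mid x - 2 ^ lo x) mod N"
  using digits[of y] by (simp add: rel_def mod_simps)

text \<open>Blocks are the values of \<open>hi x\<close>, and the row has \<open>mid y\<close> equal
  to \<open>hi x + 2 ^ lo y\<close> modulo \<open>N\<close>. As \<open>y\<close> grows,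
  \<open>mid y\<close> goes around the cycle once for each value of \<open>hi y\<close>, so
  \<open>R = N\<close>; a block also has at most \<open>N\<close> points per scale, told apart by
  \<open>mid x\<close>.\<close>

lemma strip_cost_coarse:
  assumes "1 \<le> a" "a \<le> k" "k < b" "b \<le> T" and "v = min (hi (k - 1) - hi (a - 1)) (hi (b - 1) - hi k)" "1 \<le> v"
  shows "real (strip_cost pts a b k)
    \<le> (2 ^ n :: nat) * (40 * (v * log 2 (real_of_int (hi (b - 1) - hi (a - 1)) / v)) + 4 * (real n + 1))"
proof (rule strip_cost_level[where off = 0 and \<delta> = 1 and sc = "\<lambda>p. lo (snd p - 1)" and G = "\<lambda>y. mid (y - 1)"])
  show "0 \<le> hi (a - 1)" "hi (b - 1) < 0 + N" using digits[of "a - 1"] digits[of "b - 1"] assms by auto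
  fix p assume p: "p \<in> strip pts a b"
  show "lo (snd p - 1) < n" using digits(6) strip_bounds[OF p] by blast
  show "mid (snd p - 1) = (hi (fst p - 1) - 0 + 1 * 2 ^ lo (snd p - 1)) mod N"
    using rel_strip[OF p] by (simp add: rel_def)
next
  fix z i
  let ?P = "{p \<in> strip pts a b. hi (fst p - 1) - 0 = z \<and> lo (snd p - 1) = i}"
  have "card ?P \<le> card {0..<N}"
  proof (rule card_inj_on_le[where f = "\<lambda>p. mid (fst p - 1)"])
    show "inj_on (\<lambda>p. mid (fst p - 1)) ?P"
    proof (rule inj_onI)
      fix p q assume pq: "p \<in> ?P" "q \<in> ?P" "mid (fst p - 1) = mid (fst q - 1)"
      then have pqs: "p \<in> strip pts a b" "q \<in> strip pts a b" by auto
      note d = digits[OF strip_bounds(3,4)[OF pqs(1)]] digits[OF strip_bounds(3,4)[OF pqs(2)]]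
      have "\<pi> (lo (fst p - 1)) = \<pi> (lo (fst q - 1))"
        using rel_strip[OF pqs(1)] rel_strip[OF pqs(2)] pq by (simp add: rel_def)
      then have "lo (fst p - 1) = lo (fst q - 1)"
        using \<pi> d(6,12) by (auto simp: bij_betw_def inj_on_def)
      then have "fst p = fst q" using d(1,7) pq by simp
      then show "p = q" using pqs inj_on_fst_pts by (auto simp: strip_def inj_on_def)
    qed
    show "(\<lambda>p. mid (fst p - 1)) ` ?P \<subseteq> {0..<N}"
    proof (rule image_subsetI)
      fix p assume "p \<in> ?P"
      then have "0 \<le> fst p - 1" "fst p - 1 < T" using strip_bounds(3,4) by blast+
      then show "mid (fst p - 1) \<in> {0..<N}" using digits(4,5) by simp
    qed
  qed simp
  then show "card ?P \<le> 2 ^ n" by (simp add: N_def nat_power_eq)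
next
  fix C :: "int \<Rightarrow> bool"
  show "\<exists>W. finite W \<and> card W \<le> 2 ^ n * card {g \<in> {0..<N}. C g \<noteq> C ((g + 1) mod N)} \<and>
      (\<forall>p\<in>strip pts a b. \<forall>q\<in>strip pts a b. \<forall>w. snd p \<le> w \<and> w < snd q \<and> C (mid (w - 1)) \<noteq> C (mid (w + 1 - 1)) \<longrightarrow> w \<in> W)"
    by (rule switching_set[where B = "int n"]) (use n in \<open>auto simp: T_def N_def mid_def\<close>)
qed (use assms mono_hi in auto)

lemma switching_set_hi:
  fixes C :: "int \<Rightarrow> bool"
  shows "\<exists>W. finite W \<and> card W \<le> 1 * card {g \<in> {0..<N}. C g \<noteq> C ((g + 1) mod N)} \<and>
      (\<forall>p\<in>strip pts a b. \<forall>q\<in>strip pts a b. \<forall>w. snd p \<le> w \<and> w < snd q \<and> C (hi (w - 1)) \<noteq> C (hi (w + 1 - 1)) \<longrightarrow> w \<in> W)"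
proof (rule switching_set[where B = "N * int n"])
  fix y assume "0 \<le> y" "y < T"
  then show "hi (y + 1 - 1) = y div (N * int n) mod N"
    using digits[of y] by (simp add: hi_def)
qed (use n N_pos in \<open>auto simp: T_def\<close>)

lemma same_hi:
  assumes "hi (a - 1) = hi (b - 1)" "a - 1 \<le> x" "x \<le> b - 1"
  shows "hi x = hi (a - 1)"
  using assms hi_mono[of "a - 1" x] hi_mono[of x "b - 1"] by simp

text \<open>With \<open>hi x\<close> constant, blocks are groups of \<open>n\<close> columns with a
  common \<open>mid x\<close>. By \<open>hi_rel\<close> the row has \<open>hi y\<close> equal to
  \<open>mid x - 2 ^ lo x\<close> modulo \<open>N\<close>, hence the sign; \<open>hi y\<close> goes
  around the cycle once and a block has at most one point per scale, so
  \<open>R = 1\<close>.\<close>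

lemma strip_cost_fine:
  assumes ab: "1 \<le> a" "a \<le> k" "k < b" "b \<le> T" and hi: "hi (a - 1) = hi (b - 1)"
    and v: "v = min (col_index (k - 1) - col_index (a - 1)) (col_index (b - 1) - col_index k)" "1 \<le> v"
  shows "real (strip_cost pts a b k)
    \<le> (1 :: nat) * (40 * (v * log 2 (real_of_int (col_index (b - 1) - col_index (a - 1)) / v)) + 4 * (real n + 1))"
proof (rule strip_cost_level[where off = "hi (a - 1) * N" and \<delta> = "-1" and sc = "\<lambda>p. lo (fst p - 1)" and G = "\<lambda>y. hi (y - 1)"])
  show "hi (a - 1) * N \<le> col_index (a - 1)" "col_index (b - 1) < hi (a - 1) * N + N"
    using digits[of "a - 1"] digits[of "b - 1"] mid_eq[of "a - 1"] mid_eq[of "b - 1"] ab hi by auto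
  have mid: "mid (fst p - 1) = col_index (fst p - 1) - hi (a - 1) * N" if "p \<in> strip pts a b" for p
    using mid_eq[OF strip_bounds(3,4)[OF that]] same_hi[OF hi strip_bounds(1,2)[OF that]] by simp
  fix p assume p: "p \<in> strip pts a b"
  show "lo (fst p - 1) < n" using digits(6) strip_bounds[OF p] by blast
  show "hi (snd p - 1) = (col_index (fst p - 1) - hi (a - 1) * N + - 1 * 2 ^ lo (fst p - 1)) mod N"
    using hi_rel[OF rel_strip[OF p]] mid[OF p] by simp
next
  fix z i
  let ?P = "{p \<in> strip pts a b. col_index (fst p - 1) - hi (a - 1) * N = z \<and> lo (fst p - 1) = i}"
  have "p = q" if pq: "p \<in> ?P" "q \<in> ?P" for p q
  proof -
    have pqs: "p \<in> strip pts a b" "q \<in> strip pts a b" using pq by auto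
    note b = strip_bounds[OF pqs(1)] strip_bounds[OF pqs(2)]
    have "hi (fst p - 1) = hi (fst q - 1)" using same_hi[OF hi b(1,2)] same_hi[OF hi b(7,8)] by simp
    moreover from this have "mid (fst p - 1) = mid (fst q - 1)"
      using mid_eq[OF b(3,4)] mid_eq[OF b(9,10)] pq by simp
    ultimately have "fst p = fst q"
      using digits(1)[OF b(3,4)] digits(1)[OF b(9,10)] pq by simp
    then show "p = q" using pqs inj_on_fst_pts by (auto simp: strip_def inj_on_def)
  qed
  moreover have "finite ?P" using finite_strip by (rule finite_filter)
  ultimately show "card ?P \<le> 1" unfolding One_nat_def card_le_Suc0_iff_eq[OF \<open>finite ?P\<close>] by blast
qed (use assms mono_col_index switching_set_hi in auto)

text \<open>In a single group the position \<open>c\<close> is fixed and the row digit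
  \<open>c - 2 ^ i\<close> moves backwards on the cycle as \<open>i\<close> grows. The points up to
  the cut lie in the cyclic interval from \<open>c - 2 ^ \<kappa>\<close> to \<open>c\<close>, the
  others outside it, and this interval has two ends.\<close>

lemma strip_cost_column:
  assumes ab: "1 \<le> a" "a \<le> k" "k < b" "b \<le> T" and col: "col_index (a - 1) = col_index (b - 1)"
  shows "strip_cost pts a b k \<le> 2"
proof -
  define \<kappa> where "\<kappa> = lo (k - 1)"
  define c where "c = mid (a - 1)"
  have same: "col_index x = col_index (a - 1)" if "a - 1 \<le> x" "x \<le> b - 1" for x
    using monoD[OF mono_col_index, of "a - 1" x] monoD[OF mono_col_index, of x "b - 1"] col that by simp
  have mid: "mid x = c" if "a - 1 \<le> x" "x \<le> b - 1" for x
    using same[OF that] by (simp add: c_def mid_def col_index_def)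
  have ordered: "x \<le> k - 1 \<longleftrightarrow> lo x \<le> \<kappa>" if "a - 1 \<le> x" "x \<le> b - 1" for x
  proof -
    have "x = col_index x * int n + int (lo x)" for x using n by (simp add: col_index_def lo_def)
    from this[of x] this[of "k - 1"]
    have "x = col_index (a - 1) * int n + int (lo x)" "k - 1 = col_index (a - 1) * int n + int \<kappa>"
      using same[OF that] same[of "k - 1"] ab by (simp_all add: \<kappa>_def)
    then show ?thesis by linarith
  qed
  have \<kappa>: "\<kappa> < n" unfolding \<kappa>_def using digits(6)[of "k - 1"] ab by simp
  define C where "C = (\<lambda>g. \<exists>e\<in>{c - 2 ^ \<kappa>}. (g - e) mod N \<in> {0..2 ^ \<kappa>})"
  have sw: "card {g \<in> {0..<N}. C g \<noteq> C ((g + 1) mod N)} \<le> 2"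
    using card_cyclic_intervals_switches[of 0 "2 ^ \<kappa>" N "{c - 2 ^ \<kappa>}"] power_less_N[OF \<kappa>] unfolding C_def by simp
  obtain W where W: "finite W" "card W \<le> 1 * card {g \<in> {0..<N}. C g \<noteq> C ((g + 1) mod N)}"
    "\<And>p q w. p \<in> strip pts a b \<Longrightarrow> q \<in> strip pts a b \<Longrightarrow> snd p \<le> w \<Longrightarrow> w < snd q \<Longrightarrow>
      C (hi (w - 1)) \<noteq> C (hi (w + 1 - 1)) \<Longrightarrow> w \<in> W"
    using switching_set_hi[of C a b] by blast
  have "card (alternations (strip pts a b) (\<lambda>p. fst p \<le> k)) \<le> 2 * card ({} :: point set) + card W"
  proof (rule card_alternations_le[OF finite_strip inj_on_snd_strip _ W(1), where b = "\<lambda>y. C (hi (y - 1))"])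
    fix p assume "p \<in> strip pts a b - {}"
    then have p: "p \<in> strip pts a b" by simp
    define i where "i = lo (fst p - 1)"
    have i: "i < n" unfolding i_def using digits(6) strip_bounds[OF p] by blast
    have "hi (snd p - 1) = (c - 2 ^ i) mod N"
      using hi_rel[OF rel_strip[OF p]] mid strip_bounds[OF p] by (simp add: i_def)
    then have "(hi (snd p - 1) - (c - 2 ^ \<kappa>)) mod N = (2 ^ \<kappa> - 2 ^ i) mod N"
      by (simp add: mod_simps)
    moreover have "(2 ^ \<kappa> - 2 ^ i) mod N \<in> {0..2 ^ \<kappa>} \<longleftrightarrow> i \<le> \<kappa>"
    proof (cases "i \<le> \<kappa>")
      case True
      then have "(2 :: int) ^ i \<le> 2 ^ \<kappa>" by simp
      moreover have "(2 :: int) ^ \<kappa> - 2 ^ i < N" using power_less_N[OF \<kappa>] zero_less_power[of "2 :: int" i] by linarith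
      ultimately show ?thesis using True by simp
    next
      case False
      then have "(2 :: int) ^ \<kappa> < 2 ^ i" by simp
      then have "(2 ^ \<kappa> - 2 ^ i) mod N = N + (2 ^ \<kappa> - 2 ^ i)"
        using power_less_N[OF i] zero_less_power[of "2 :: int" \<kappa>]
          mod_pos_pos_trivial[of "N + (2 ^ \<kappa> - 2 ^ i)" N] by (simp del: zero_less_power)
      then show ?thesis using False power_less_N[OF i] by simp
    qed
    moreover have "fst p \<le> k \<longleftrightarrow> i \<le> \<kappa>"
    proof -
      have "fst p - 1 \<le> k - 1 \<longleftrightarrow> i \<le> \<kappa>"
        unfolding i_def by (rule ordered) (fact strip_bounds(1,2)[OF p])+
      then show ?thesis by linarith
    qed
    ultimately show "(fst p \<le> k) = C (hi (snd p - 1))" by (simp add: C_def)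
  qed (use W(3) in auto)
  with W(2) sw show ?thesis by (simp add: strip_cost_def)
qed

text \<open>The first summand drops by \<open>2\<close> with every cut and pays for cuts inside one
  group of columns. The others pay for cuts across groups of one cell and across cells; their
  weights are the multiplicities \<open>R\<close> of the two levels.\<close>

definition potential :: "int \<Rightarrow> int \<Rightarrow> real" where
  "potential a b = 2 * (real_of_int b - a) + level_potential n 1 col_index a b + level_potential n (2 ^ n) hi a b"

lemma potential_nonneg: "a \<le> b \<Longrightarrow> 0 \<le> potential a b"
  unfolding potential_def using level_potential_nonneg[OF mono_col_index] level_potential_nonneg[OF mono_hi]
  by simp

text \<open>The coarsest level on which the strip still has a boundary pays; on the other levels
  superadditivity suffices.\<close>

lemma potential_step:
  assumes ab: "1 \<le> a" "a \<le> k" "k < b" "b \<le> T"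
  shows "real (strip_cost pts a b k) + potential a k + potential (k + 1) b \<le> potential a b"
proof -
  note cl = strip_cost_le_left[OF ab(2,3)] and cr = strip_cost_le_right[OF ab(2,3)]
  note sc = level_potential_superadd[OF mono_col_index ab(2,3), of n 1]
    and sh = level_potential_superadd[OF mono_hi ab(2,3), of n "2 ^ n"]
  consider "hi (a - 1) < hi (b - 1)" | "hi (a - 1) = hi (b - 1)" "col_index (a - 1) < col_index (b - 1)"
    | "col_index (a - 1) = col_index (b - 1)"
    using hi_mono[of "a - 1" "b - 1"] monoD[OF mono_col_index, of "a - 1" "b - 1"] ab by linarith
  then show ?thesis
  proof cases
    case 1
    have "real (strip_cost pts a b k) + level_potential n (2 ^ n) hi a k + level_potential n (2 ^ n) hi (k + 1) b
        \<le> level_potential n (2 ^ n) hi a b"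
      by (rule level_potential_step[OF mono_hi ab(2,3) 1 cl cr strip_cost_coarse[OF ab]])
    with sc show ?thesis unfolding potential_def by simp
  next
    case 2
    have "real (strip_cost pts a b k) + level_potential n 1 col_index a k + level_potential n 1 col_index (k + 1) b
        \<le> level_potential n 1 col_index a b"
      by (rule level_potential_step[OF mono_col_index ab(2,3) 2(2) cl cr strip_cost_fine[OF ab 2(1)]])
    with sh show ?thesis unfolding potential_def by simp
  next
    case 3
    then have "real (strip_cost pts a b k) \<le> 2" using strip_cost_column[OF ab] by simp
    with sc sh show ?thesis unfolding potential_def by simp
  qed
qed

lemma xlogx_potential_le:
  assumes "0 \<le> u" "real_of_int u \<le> 2 ^ j"
  shows "xlogx_potential n R u \<le> R * ((40 * j + 4 * (real n + 1)) * 2 ^ j)"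
proof (cases "u = 0")
  case False
  then have u: "1 \<le> u" using assms by simp
  have "log 2 u \<le> log 2 (2 ^ j)" using u assms(2) by (subst log_le_cancel_iff) auto
  then have "u * log 2 u \<le> 2 ^ j * real j" using u assms(2) by (intro mult_mono) (auto simp: log_nat_power)
  moreover have "real_of_int u - 1 \<le> 2 ^ j" using assms(2) by linarith
  then have "4 * (real n + 1) * max 0 (real_of_int u - 1) \<le> 4 * (real n + 1) * 2 ^ j"
    by (intro mult_left_mono max.boundedI) auto
  ultimately show ?thesis unfolding xlogx_potential_def by (intro mult_left_mono) (auto simp: algebra_simps)
qed (simp add: xlogx_potential_def)

text \<open>\<open>142 = 2 + 2 + 2 + 88 + 48\<close>: three linear summands, fewer than
  \<open>N * N\<close> boundaries of weight \<open>1\<close> with logarithm at most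
  \<open>2 * n\<close>, and fewer than \<open>N\<close> boundaries of weight \<open>N\<close> with
  logarithm at most \<open>n\<close>. The factor \<open>n\<close> in \<open>T\<close> absorbs the
  logarithms.\<close>

lemma potential_total: "potential 1 T \<le> 142 * T"
proof -
  have T: "real_of_int T = 2 ^ n * 2 ^ n * n" by (simp add: T_def N_def)
  have "0 < T" using N_pos n by (simp add: T_def)
  then have T1: "1 \<le> T" by simp
  have n1: "1 \<le> real n" using n by simp
  have c0: "col_index 0 = 0" "hi 0 = 0" by (simp_all add: col_index_def hi_def)
  have "0 \<le> col_index (T - 1)" "0 \<le> hi (T - 1)"
    using monoD[OF mono_col_index, of 0 "T - 1"] hi_mono[of 0 "T - 1"] T1 c0 by simp_all
  moreover have "col_index (T - 1) < N * N" "hi (T - 1) < N"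
    using n digits(3)[of "T - 1"] T1 by (auto simp: col_index_def T_def intro!: int_div_less)
  then have "real_of_int (col_index (T - 1)) < real_of_int (N * N)" "real_of_int (hi (T - 1)) < real_of_int N"
    by (simp_all only: of_int_less_iff)
  then have "real_of_int (col_index (T - 1)) \<le> 2 ^ (2 * n)" "real_of_int (hi (T - 1)) \<le> 2 ^ n"
    by (simp_all add: N_def power_mult power2_eq_square mult_2 power_add)
  ultimately have x: "xlogx_potential n 1 (col_index (T - 1)) \<le> 1 * ((40 * (2 * real n) + 4 * (real n + 1)) * 2 ^ (2 * n))"
    "xlogx_potential n (2 ^ n) (hi (T - 1)) \<le> 2 ^ n * ((40 * real n + 4 * (real n + 1)) * 2 ^ n)"
    using xlogx_potential_le[of "col_index (T - 1)" "2 * n" 1] xlogx_potential_le[of "hi (T - 1)" n "2 ^ n"] by auto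
  have l1: "level_potential n 1 col_index 1 T \<le> 2 * T + xlogx_potential n 1 (col_index (T - 1))"
    and l2: "level_potential n (2 ^ n) hi 1 T \<le> 2 * T + xlogx_potential n (2 ^ n) (hi (T - 1))"
    using T1 by (simp_all add: level_potential_def c0)
  have "(40 * (2 * real n) + 4 * (real n + 1)) * 2 ^ (2 * n) \<le> (88 * real n) * 2 ^ (2 * n)"
    using n1 by (intro mult_right_mono) auto
  also have "\<dots> = 88 * real_of_int T" by (simp add: T mult_2 power_add)
  finally have b1: "xlogx_potential n 1 (col_index (T - 1)) \<le> 88 * T" using x(1) by simp
  have "2 ^ n * ((40 * real n + 4 * (real n + 1)) * 2 ^ n) \<le> 2 ^ n * ((48 * real n) * 2 ^ n)"
    using n1 by (intro mult_left_mono mult_right_mono) auto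
  also have "\<dots> = 48 * real_of_int T" by (simp add: T)
  finally have b2: "xlogx_potential n (2 ^ n) (hi (T - 1)) \<le> 48 * T" using x(2) by simp
  from l1 l2 b1 b2 show ?thesis unfolding potential_def by simp
qed

text \<open>Vertical cuts cost at most \<open>142 * T\<close>, and so do horizontal cuts by way of
  the inverse permutation.\<close>

lemma cGB_pts_le: "real (cGB pts) \<le> 284 * T"
proof -
  interpret inverse: shift_grid n "inv_into {..<n} \<pi>" by (rule inverse_shift_grid)
  have "0 < T" using N_pos n by (simp add: T_def)
  then have T1: "1 \<le> T" by simp
  have sigma: "real (cGB_sigma pts \<sigma>) \<le> 284 * T" for \<sigma>
  proof -
    have "{(1, int (card pts), 1, int (card pts))} = grid {(1, T)} {(1, T)}"
      by (auto simp: grid_def card_pts)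
    moreover have "real (cGB_run pts (grid {(1, T)} {(1, T)}) \<sigma>)
        \<le> (\<Sum>(a, b)\<in>{(1, T)}. potential a b) + (\<Sum>(c, d)\<in>{(1, T)}. inverse.potential c d)"
    proof (rule cGB_run_le[where m = T])
      fix a b k assume "1 \<le> a" "a \<le> k" "k < b" "b \<le> T"
      then show "real (strip_cost pts a b k) + potential a k + potential (k + 1) b \<le> potential a b"
        and "real (strip_cost (prod.swap ` pts) a b k) + inverse.potential a k + inverse.potential (k + 1) b
          \<le> inverse.potential a b"
        using potential_step inverse.potential_step by (simp_all add: pts_inverse)
    qed (use T1 finite_pts potential_nonneg inverse.potential_nonneg in \<open>auto simp: interval_family_def\<close>)
    ultimately show ?thesis unfolding cGB_sigma_def using potential_total inverse.potential_total by simp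
  qed
  have fin: "finite (glines (card pts))" by (simp add: glines_def)
  let ?M = "{cGB_sigma pts \<sigma> | \<sigma>. distinct \<sigma> \<and> set \<sigma> = glines (card pts)}"
  have "?M = cGB_sigma pts ` {\<sigma>. distinct \<sigma> \<and> set \<sigma> = glines (card pts)}" by auto
  moreover have "finite {\<sigma>. distinct \<sigma> \<and> set \<sigma> = glines (card pts)}"
    by (rule finite_subset[OF _ finite_subset_distinct[OF fin]]) auto
  ultimately have "finite ?M" by simp
  moreover have "?M \<noteq> {}" using finite_distinct_list[OF fin] by blast
  ultimately have "cGB pts \<in> ?M" unfolding cGB_def by (rule Max_in)
  with sigma show ?thesis by auto
qed

end

section \<open>Choice of the parameters\<close>

theorem theorem1p2:
  shows "\<exists>c1 c2 :: real. c1 > 0 \<and> c2 > 0 \<and>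
    (\<forall>n' :: int. \<exists>(n :: nat) (X :: point set).
       int n \<ge> n' \<and> card X = n \<and> is_permutation X \<and>
       fst ` X = {1..int n} \<and> snd ` X = {1..int n} \<and>
       real (opt X) \<ge> c1 * real n * ln (ln (real n)) \<and>
       real (cGB X) \<le> c2 * real n * ln (ln (ln (real n))))"
proof (rule exI[of _ "1 / 32"], rule exI[of _ 284], intro conjI allI)
  fix n' :: int
  \<comment> \<open>\<open>l >= 16\<close> gives \<open>l / 8 - 1 >= l / 16\<close> for the bound on
    \<open>opt\<close>, and \<open>l * ln 2 >= exp 1\<close>, so that the triple logarithm is at
    least \<open>1\<close>. The summand \<open>nat n'\<close> makes the set large enough.\<close>
  define l where "l = 16 + nat n'"
  define n :: nat where "n = 2 ^ l"
  interpret shift_grid n "bitrev l"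
    using bij_betw_bitrev by unfold_locales (simp_all add: n_def)
  have T: "real_of_int T = 2 ^ n * 2 ^ n * n" by (simp add: T_def N_def)
  have cardT: "real (card pts) = T" by (metis card_pts of_int_of_nat_eq)
  have "l \<le> n" unfolding n_def by (rule less_imp_le) (rule less_exp)
  then have n16: "16 \<le> l" "real l \<le> n" "1 \<le> real n"
    by (simp add: l_def, simp only: of_nat_le_iff, simp add: n_def)
  \<comment> \<open>The number of points is \<open>T\<close>, not the local \<open>n\<close>. Its
    logarithm has order \<open>n = 2 ^ l\<close>, so the double logarithm has order
    \<open>l\<close>.\<close>
  have lnT: "ln (real_of_int T) = 2 * n * ln 2 + l * ln 2"
    unfolding T by (simp add: ln_mult ln_realpow n_def)
  have ln2: "1 / 2 \<le> ln (2 :: real)" "ln (2 :: real) \<le> 1"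
    using exp_half_le2 ln_ge_iff[of 2 "1 / 2"] ln_le_minus_one[of 2] by simp_all
  have lower: "real n \<le> ln (real_of_int T)"
  proof -
    have "real n \<le> 2 * n * ln 2" using ln2 n16 by simp
    moreover have "0 \<le> l * ln (2 :: real)" by simp
    ultimately show ?thesis unfolding lnT by linarith
  qed
  have upper: "ln (real_of_int T) \<le> 3 * n"
  proof -
    have "2 * real n * ln 2 \<le> 2 * real n * 1" using ln2(2) by (intro mult_left_mono) simp_all
    moreover have "real l * ln 2 \<le> real l * 1" using ln2(2) by (intro mult_left_mono) simp_all
    ultimately show ?thesis unfolding lnT using n16(2) by linarith
  qed
  have lnn: "ln (real n) = l * ln 2" by (simp add: n_def ln_realpow)
  have "ln (ln (real_of_int T)) \<le> ln (3 * real n)" using upper lower n16 by simp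
  also have "\<dots> = ln 3 + l * ln 2" using n16 lnn by (simp add: ln_mult)
  also have "\<dots> \<le> 2 + real l * 1"
    using ln_add_one_self_le_self2[of 2] ln2 by (intro add_mono mult_left_mono) auto
  finally have lnlnT: "ln (ln (real_of_int T)) \<le> 2 * l" using n16 by simp
  have "exp 1 \<le> (3 :: real)" by (rule exp_le)
  also have "\<dots> \<le> l * ln 2" using ln2 n16 mult_mono[of 16 "real l" "1 / 2" "ln 2"] by simp
  also have "\<dots> \<le> ln (ln (real_of_int T))" unfolding lnn[symmetric] using lower n16 by simp
  finally have "ln (exp 1) \<le> ln (ln (ln (real_of_int T)))"
    by (subst ln_le_cancel_iff) (auto intro: less_le_trans[OF exp_gt_zero])
  then have lnlnlnT: "1 \<le> ln (ln (ln (real_of_int T)))" by simp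
  have optT: "T * l \<le> 8 * (T + real (opt pts))"
  proof -
    have "2 ^ n * 2 ^ n * n * l \<le> 8 * (card pts + opt pts)"
      using opt_pts_lower[of l] by (simp add: n_def)
    then have "real (2 ^ n * 2 ^ n * n * l) \<le> real (8 * (card pts + opt pts))" by (simp only: of_nat_le_iff)
    then show ?thesis by (simp add: T cardT)
  qed
  have T0: "0 \<le> real_of_int T" unfolding T by simp
  show "\<exists>n X. n' \<le> int n \<and> card X = n \<and> is_permutation X \<and> fst ` X = {1..int n} \<and> snd ` X = {1..int n} \<and>
      1 / 32 * real n * ln (ln (real n)) \<le> real (opt X) \<and> real (cGB X) \<le> 284 * real n * ln (ln (ln (real n)))"
  proof (rule exI[of _ "card pts"], rule exI[of _ pts], intro conjI)
    show "card pts = card pts" "is_permutation pts" by (rule refl is_permutation_pts)+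
    show "n' \<le> int (card pts)"
    proof -
      have "real l * 1 \<le> ln (real_of_int T) * 1" using lower n16 by simp
      also have "\<dots> \<le> T" using ln_le_minus_one[of "real_of_int T"] lower n16 T0
        by (cases "T = 0") auto
      finally have "real_of_int (int l) \<le> real_of_int T" by simp
      then have "int l \<le> T" by (simp only: of_int_le_iff)
      moreover have "n' \<le> int l" by (simp add: l_def)
      ultimately show ?thesis unfolding card_pts by linarith
    qed
    show "fst ` pts = {1..int (card pts)}" "snd ` pts = {1..int (card pts)}"
      by (simp_all add: card_pts fst_pts snd_pts)
    \<comment> \<open>\<open>optT\<close> and \<open>l >= 16\<close> give at least
      \<open>T * l / 16\<close> for \<open>opt\<close>; since the double logarithm is at most
      \<open>2 * l\<close>, the constant becomes \<open>1 / 32\<close>.\<close>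
    have "T * ln (ln (real_of_int T)) \<le> T * (2 * real l)" using T0 lnlnT by (intro mult_left_mono) simp_all
    moreover have "T * real 16 \<le> T * real l" using T0 n16 by (intro mult_left_mono) auto
    ultimately show "1 / 32 * real (card pts) * ln (ln (real (card pts))) \<le> real (opt pts)"
      using optT unfolding cardT by simp
    have "real_of_int T * 1 \<le> T * ln (ln (ln (real_of_int T)))" using T0 lnlnlnT by (intro mult_left_mono)
    then show "real (cGB pts) \<le> 284 * real (card pts) * ln (ln (ln (real (card pts))))"
      using cGB_pts_le unfolding cardT by simp
  qed
qed simp_all

end
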